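(* Let $A$ be a nonsingular real $n\times n$ matrix and let $K:\mathbb{R}^n\to\mathbb{R}$ satisfy $K\in L_2(\mathbb{R}^n)\cap L_1(\mathbb{R}^n)\cap C(\mathbb{R}^n)$. Assume that $$\sum_{m\in\mathbb{Z}^n}\mathbf{F}(K)\left(z+2\pi (A^{-1})^{T}m\right)\neq 0\qquad\text{for all } z\in 2\pi (A^{-1})^{T}Q,$$ where $Q:=\{x=(x_1,\dots,x_n)\in\mathbb{R}^n : 0\le x_k\le 1,\ 1\le k\le n\}$, and that the function $$\Upsilon(z):=\frac{1}{\sum_{m\in\mathbb{Z}^n}\mathbf{F}(K)\left(z+2\pi (A^{-1})^{T}m\right)}$$ can be represented by its Fourier series, i.e. for any $z\in\mathbb{R}^n$, $$\Upsilon(z)=\sum_{s\in\mathbb{Z}^n}\alpha_s\exp\left(-i\langle As,z\rangle\right).$$ Then the function $$\widetilde{sk}(x)=\frac{|\det(A)|}{(2\pi)^n}\int_{\mathbb{R}^n}\Upsilon(z)\,\mathbf{F}(K)(z)\,\exp\left(i\langle z,x\rangle\right)dz$$ is a fundamental $sk$-spline, i.e. $\widetilde{sk}\in SK(\Omega_A)$ with $\widetilde{sk}(0)=1$ and $\widetilde{sk}(As)=0$ for all $s\in\mathbb{Z}^n\setminus\{0\}$, and this representation is unique, i.e. the fundamental $sk$-spline in $SK(\Omega_A)$ is unique and is given by this formula.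
   Context: $\langle x,y\rangle=\sum_{k=1}^n x_ky_k$ is the usual scalar product on $\mathbb{R}^n$. The Fourier transform of $f\in L_1(\mathbb{R}^n)$ is $\mathbf{F}f(y)=\int_{\mathbb{R}^n}\exp(-i\langle x,y\rangle)f(x)\,dx$, with formal inverse $(\mathbf{F}^{-1}f)(x)=\frac{1}{(2\pi)^n}\int_{\mathbb{R}^n}\exp(i\langle x,y\rangle)f(y)\,dy$ (extended to $L_2(\mathbb{R}^n)$ by Plancherel's theorem). For a nonsingular $n\times n$ matrix $A$, $\Omega_A=\{x_m:=Am : m\in\mathbb{Z}^n\}$. For the fixed continuous kernel $K$, $SK(\Omega_A)$ is the space of $sk$-splines on $\Omega_A$, i.e. of functions in $L_2(\mathbb{R}^n)$ representable in the form $sk(x)=\sum_{m\in\mathbb{Z}^n}c_mK(x-x_m)$ with $c_m\in\mathbb{R}$. A fundamental (cardinal) $sk$-spline is a function $\widetilde{sk}\in SK(\Omega_A)$ such that $\widetilde{sk}(x_s)=1$ for $s=0$ and $\widetilde{sk}(x_s)=0$ for $s\in\mathbb{Z}^n$, $s\neq 0$.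
   Formalization: The integral defining the spline is assumed to converge absolutely for every x; sums over Z^n are unordered; membership in SK requires the series to converge both pointwise and in L_2, since with pointwise convergence alone uniqueness fails (e.g. for a Gaussian K). *)

theory Defs
  imports "HOL-Analysis.Analysis"
begin

definition int_vec :: "int ^ 'n \<Rightarrow> real ^ 'n" where
  "int_vec m = (\<chi> i. real_of_int (m $ i))"

definition lattice_pt :: "real ^ 'n ^ 'n \<Rightarrow> int ^ 'n \<Rightarrow> real ^ 'n" where
  "lattice_pt A m = A *v int_vec m"

definition dual_map :: "real ^ 'n ^ 'n \<Rightarrow> real ^ 'n \<Rightarrow> real ^ 'n" where
  "dual_map A v = (2 * pi) *\<^sub>R (transpose (matrix_inv A) *v v)"

definition unit_cube :: "(real ^ 'n) set" where
  "unit_cube = {x. \<forall>k. 0 \<le> x $ k \<and> x $ k \<le> 1}"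

definition in_L1 :: "(real ^ 'n \<Rightarrow> complex) \<Rightarrow> bool" where
  "in_L1 f \<longleftrightarrow> integrable lebesgue f"

definition in_L2 :: "(real ^ 'n \<Rightarrow> complex) \<Rightarrow> bool" where
  "in_L2 f \<longleftrightarrow> f \<in> borel_measurable lebesgue \<and> integrable lebesgue (\<lambda>x. (norm (f x))\<^sup>2)"

definition fourier :: "(real ^ 'n \<Rightarrow> complex) \<Rightarrow> real ^ 'n \<Rightarrow> complex" where
  "fourier f y = (LINT x|lebesgue. exp (- \<i> * complex_of_real (x \<bullet> y)) * f x)"

text \<open>Series over the integer lattice carry no order of summation, so all of them are read
  as unordered sums (infinite sum, has_sum, or a limit along the finite subsets). Where the
  sum below does not converge, infsum is 0; requiring it to be nonzero includes convergence.\<close>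

definition periodization :: "real ^ 'n ^ 'n \<Rightarrow> (real ^ 'n \<Rightarrow> complex) \<Rightarrow> real ^ 'n \<Rightarrow> complex" where
  "periodization A f z = infsum (\<lambda>m :: int ^ 'n. f (z + dual_map A (int_vec m))) UNIV"

definition Upsilon :: "real ^ 'n ^ 'n \<Rightarrow> (real ^ 'n \<Rightarrow> real) \<Rightarrow> real ^ 'n \<Rightarrow> complex" where
  "Upsilon A K z = 1 / periodization A (fourier (\<lambda>x. complex_of_real (K x))) z"

text \<open>The series representing a spline converges to it both at every point (the values at
  lattice points must make sense) and in the norm of \<open>L\<^sub>2\<close>. Pointwise
  convergence alone is too weak for interpolation to be unique: for
  \<open>K x = exp (- x\<^sup>2)\<close> on the line and \<open>A = 1\<close>, let \<open>d m\<close> be the Laurent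
  coefficients of \<open>\<theta> w * exp (- w - 1 / w)\<close>, with \<open>\<theta>\<close> a theta function vanishing
  exactly at the points \<open>exp (2 * s)\<close>, \<open>s\<close> an integer. With \<open>c m = exp (m\<^sup>2) * d m\<close>
  the series converges absolutely and locally uniformly to a nonzero square integrable function
  that vanishes at all integers.\<close>

definition sk_series :: "real ^ 'n ^ 'n \<Rightarrow> (real ^ 'n \<Rightarrow> real) \<Rightarrow> (int ^ 'n \<Rightarrow> real)
    \<Rightarrow> (real ^ 'n \<Rightarrow> complex) \<Rightarrow> bool" where
  "sk_series A K c f \<longleftrightarrow>
     (\<forall>x. ((\<lambda>m. complex_of_real (c m * K (x - lattice_pt A m))) has_sum f x) UNIV) \<and>
     ((\<lambda>F. \<integral>\<^sup>+ x. ennreal ((norm (f x -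
         (\<Sum>m\<in>F. complex_of_real (c m * K (x - lattice_pt A m)))))\<^sup>2) \<partial>lebesgue)
       \<longlongrightarrow> 0) (finite_subsets_at_top UNIV)"

definition SK :: "real ^ 'n ^ 'n \<Rightarrow> (real ^ 'n \<Rightarrow> real) \<Rightarrow> (real ^ 'n \<Rightarrow> complex) set" where
  "SK A K = {f. in_L2 f \<and> (\<exists>c. sk_series A K c f)}"

definition fundamental_sk_spline ::
    "real ^ 'n ^ 'n \<Rightarrow> (real ^ 'n \<Rightarrow> real) \<Rightarrow> (real ^ 'n \<Rightarrow> complex) \<Rightarrow> bool" where
  "fundamental_sk_spline A K f \<longleftrightarrow>
     f \<in> SK A K \<and> (\<forall>s. f (lattice_pt A s) = (if s = 0 then 1 else 0))"

definition sk_tilde :: "real ^ 'n ^ 'n \<Rightarrow> (real ^ 'n \<Rightarrow> real) \<Rightarrow> real ^ 'n \<Rightarrow> complex" where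
  "sk_tilde A K x =
     complex_of_real (\<bar>det A\<bar> / (2 * pi) ^ CARD('n)) *
     (LINT z|lebesgue. Upsilon A K z * fourier (\<lambda>x. complex_of_real (K x)) z *
        exp (\<i> * complex_of_real (z \<bullet> x)))"

end

theory Submission
  imports Defs "HOL-Probability.Characteristic_Functions"
begin

text \<open>
  Write \<open>F K\<close> (in the code \<open>FK\<close>) for the Fourier transform of the kernel, \<open>P\<close> for its
  periodization over the dual lattice, and \<open>\<Upsilon> = 1 / P\<close> (in the code \<open>U\<close>). The Fourier
  series of \<open>\<Upsilon>\<close> converges unordered at the origin, hence \<open>\<Sum>\<bar>\<alpha> s\<bar> < \<infinity>\<close>, and \<open>\<Upsilon>\<close> is
  continuous and periodic. It has no zeros, so by compactness of a period cell it is
  bounded away from zero (\<open>U_bounded_below\<close>). As \<open>\<Upsilon> F K\<close> is integrable, so is \<open>F K\<close>, and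
  Fourier inversion holds at every point (\<open>fourier_inversion\<close>).

  Existence. Inserting the series of \<open>\<Upsilon>\<close> into the integral and inverting term by term
  gives \<open>\<bar>det A\<bar> * (\<Sum>s. \<alpha> s * K (x - A s))\<close> (\<open>sk_tilde_has_sum\<close>). The coefficients are
  real because \<open>K\<close> is, and absolutely summable, so the series also converges in \<open>L\<^sub>2\<close> by
  the Cauchy-Schwarz inequality (\<open>spline_L2_bound\<close>). At a lattice point \<open>A s\<close> the integral
  is folded onto one period cell of the dual lattice (\<open>unfold_over_dual_lattice\<close>). There
  the sum over the lattice turns \<open>\<Upsilon> F K\<close> into \<open>\<Upsilon> P = 1\<close>, and what is left is the integral
  of a character over the cell, which is \<open>0\<close> unless \<open>s = 0\<close>.

  Uniqueness. If \<open>c\<close> are the coefficients of any fundamental spline, \<open>a = \<bar>det A\<bar> * \<alpha>\<close>,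
  and \<open>b s = K (A s)\<close>, then the interpolation conditions say that \<open>c * b = e = a * b\<close> for
  the convolution on the group of integer vectors, where \<open>e\<close> is \<open>1\<close> at the origin and \<open>0\<close>
  elsewhere. So formally \<open>a = a * (b * c) = (a * b) * c = c\<close>. Rearranging the double
  series is legitimate once \<open>a\<close> is absolutely summable and \<open>b\<close> and \<open>c\<close> are square summable
  (\<open>convolution_inverse_unique\<close>). For \<open>b\<close> this is Bessel's inequality, since its terms are
  the Fourier coefficients of the bounded function \<open>P\<close>, up to a constant factor. For \<open>c\<close>
  it comes from the convergence in \<open>L\<^sub>2\<close> and the lower Riesz bound \<open>\<delta> * (\<Sum>m\<in>F. (c m)\<^sup>2) \<le>
  \<parallel>\<Sum>m\<in>F. c m * K (x - A m)\<parallel>\<^sup>2\<close> (\<open>spline_L2_lower_bound\<close>). By Plancherel's theorem that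
  bound needs \<open>\<Sum>m. \<bar>F K (z + m)\<bar>\<^sup>2\<close>, with \<open>m\<close> running through the dual lattice, to stay
  away from zero, which holds because \<open>P\<close> has no zeros.
\<close>

section \<open>Unordered sums under the integral\<close>

text \<open>Enumerates a countable index type inside the natural numbers and pads with zeros, so that finite and
  infinite index types are covered alike.\<close>

lemma has_sum_countable_as_nat:
  fixes h :: "'i::countable \<Rightarrow> 'b::topological_comm_monoid_add"
  shows "((\<lambda>n. if n \<in> range (to_nat :: 'i \<Rightarrow> nat) then h (from_nat n) else 0) has_sum s) UNIV
    \<longleftrightarrow> (h has_sum s) UNIV"
proof -
  let ?h = "\<lambda>n. if n \<in> range (to_nat :: 'i \<Rightarrow> nat) then h (from_nat n) else 0"
  have "(?h has_sum s) UNIV \<longleftrightarrow> (?h has_sum s) (range (to_nat :: 'i \<Rightarrow> nat))"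
    by (rule has_sum_cong_neutral) auto
  also have "\<dots> \<longleftrightarrow> ((?h \<circ> to_nat) has_sum s) (UNIV :: 'i set)"
    by (rule has_sum_reindex) simp
  also have "?h \<circ> to_nat = h"
    by (auto simp: fun_eq_iff)
  finally show ?thesis .
qed

text \<open>Unordered convergence of complex numbers is absolute, so along the enumeration this is the termwise
  integration of a series whose integrated norms are summable.\<close>

lemma integral_has_sum:
  fixes f :: "'i::countable \<Rightarrow> 'a \<Rightarrow> complex"
  assumes int: "\<And>i. integrable M (f i)"
    and summable: "(\<lambda>i. LINT x|M. norm (f i x)) summable_on UNIV"
    and sum: "\<And>x. ((\<lambda>i. f i x) has_sum g x) UNIV"
  shows "integrable M g" and "((\<lambda>i. integral\<^sup>L M (f i)) has_sum integral\<^sup>L M g) UNIV"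
proof -
  let ?R = "range (to_nat :: 'i \<Rightarrow> nat)"
  define f' where "f' n = (\<lambda>x. if n \<in> ?R then f (from_nat n) x else 0)" for n
  have hs: "((\<lambda>n. f' n x) has_sum g x) UNIV" for x
    using sum[of x] has_sum_countable_as_nat[of "\<lambda>i. f i x" "g x"] by (simp add: f'_def)
  then have suminf: "(\<lambda>n. f' n x) sums g x" for x
    by (rule has_sum_imp_sums)
  have int': "integrable M (f' n)" for n
    using int by (cases "n \<in> ?R") (simp_all add: f'_def)
  have norms: "summable (\<lambda>n. norm (f' n x))" for x
  proof -
    have "(\<lambda>n. norm (f' n x)) summable_on UNIV"
      using hs[of x] by (metis has_sum_imp_summable summable_on_iff_abs_summable_on_complex)
    then show ?thesis
      by (rule summable_on_imp_summable)
  qed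
  obtain S where "((\<lambda>i. LINT x|M. norm (f i x)) has_sum S) UNIV"
    using summable by (auto simp: summable_on_def)
  then have "((\<lambda>n. if n \<in> ?R then LINT x|M. norm (f (from_nat n) x) else 0) has_sum S) UNIV"
    by (rule iffD2[OF has_sum_countable_as_nat[of "\<lambda>i. LINT x|M. norm (f i x)" S]])
  also have "(\<lambda>n. if n \<in> ?R then LINT x|M. norm (f (from_nat n) x) else 0)
      = (\<lambda>n. LINT x|M. norm (f' n x))"
    by (auto simp: f'_def fun_eq_iff)
  finally have ints: "summable (\<lambda>n. LINT x|M. norm (f' n x))"
    by (auto intro: summable_on_imp_summable has_sum_imp_summable)
  have g: "(\<lambda>x. \<Sum>n. f' n x) = g"
    using suminf by (auto simp: fun_eq_iff sums_iff)
  show "integrable M g"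
    using integrable_suminf[OF int' _ ints] norms by (simp add: g)
  have "(\<lambda>n. integral\<^sup>L M (f' n)) sums integral\<^sup>L M g"
    using sums_integral[OF int' _ ints] norms by (simp add: g)
  moreover have "summable (\<lambda>n. norm (integral\<^sup>L M (f' n)))"
    by (rule summable_comparison_test'[OF ints, of 0]) simp
  ultimately have "((\<lambda>n. integral\<^sup>L M (f' n)) has_sum integral\<^sup>L M g) UNIV"
    by (intro norm_summable_imp_has_sum)
  also have "(\<lambda>n. integral\<^sup>L M (f' n)) = (\<lambda>n. if n \<in> ?R then integral\<^sup>L M (f (from_nat n)) else 0)"
    by (auto simp: f'_def fun_eq_iff)
  finally show "((\<lambda>i. integral\<^sup>L M (f i)) has_sum integral\<^sup>L M g) UNIV"
    by (rule iffD1[OF has_sum_countable_as_nat])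
qed

section \<open>Linear substitutions in the Lebesgue integral\<close>

text \<open>A shear moves the coordinate \<open>m\<close> by an amount that depends on the other coordinates only, so
  integrating over that coordinate first reduces the claim to the translation invariance on the line.\<close>

lemma nn_integral_shear:
  fixes f :: "real ^ 'n \<Rightarrow> ennreal"
  assumes [measurable]: "f \<in> borel_measurable borel" and mn: "m \<noteq> n"
  shows "(\<integral>\<^sup>+x. f (x + (c * x $ n) *\<^sub>R axis m 1) \<partial>lborel) = (\<integral>\<^sup>+x. f x \<partial>lborel)"
proof -
  let ?B = "Basis :: (real ^ 'n) set" and ?m = "axis m 1 :: real ^ 'n" and ?n = "axis n 1 :: real ^ 'n"
  let ?v = "\<lambda>y. \<Sum>b\<in>?B. y b *\<^sub>R b"
  interpret product_sigma_finite "\<lambda>_. lborel :: real measure" ..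
  have mB: "?m \<in> ?B" and nB: "?n \<in> ?B" and ne: "?n \<noteq> ?m"
    using mn by (auto simp: axis_eq_axis)
  have split: "(\<integral>\<^sup>+x. h x \<partial>lborel) =
      (\<integral>\<^sup>+y. (\<integral>\<^sup>+t. h (?v (y(?m := t))) \<partial>lborel) \<partial>(\<Pi>\<^sub>M b\<in>?B - {?m}. lborel))"
    if [measurable]: "h \<in> borel_measurable borel" for h :: "real ^ 'n \<Rightarrow> ennreal"
  proof -
    have "(\<integral>\<^sup>+x. h x \<partial>lborel) = (\<integral>\<^sup>+y. h (?v y) \<partial>(\<Pi>\<^sub>M b\<in>?B. lborel))"
      by (subst lborel_eq) (simp add: nn_integral_distr)
    also have "?B = insert ?m (?B - {?m})"
      using mB by auto
    also have "(\<integral>\<^sup>+y. h (\<Sum>b\<in>insert ?m (?B - {?m}). y b *\<^sub>R b) \<partial>(\<Pi>\<^sub>M b\<in>insert ?m (?B - {?m}). lborel)) =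
        (\<integral>\<^sup>+y. (\<integral>\<^sup>+t. h (\<Sum>b\<in>insert ?m (?B - {?m}). (y(?m := t)) b *\<^sub>R b) \<partial>lborel)
          \<partial>(\<Pi>\<^sub>M b\<in>?B - {?m}. lborel))"
      by (rule product_nn_integral_insert) auto
    also have "insert ?m (?B - {?m}) = ?B"
      using mB by auto
    finally show ?thesis .
  qed
  have shift: "?v (y(?m := t)) + (c * ?v (y(?m := t)) $ n) *\<^sub>R ?m = ?v (y(?m := c * y ?n + 1 * t))"
    for y :: "real ^ 'n \<Rightarrow> real" and t
  proof -
    have "?v (y(?m := t)) $ n = ?v (y(?m := t)) \<bullet> ?n"
      by (simp add: inner_axis)
    also have "\<dots> = (y(?m := t)) ?n"
      using nB by (simp only: inner_sum_left_Basis)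
    also have "\<dots> = y ?n"
      using ne by simp
    finally have *: "?v (y(?m := t)) $ n = y ?n" .
    have r: "?v (y(?m := s)) = s *\<^sub>R ?m + (\<Sum>b\<in>?B - {?m}. y b *\<^sub>R b)" for s
      using mB by (subst sum.remove[of _ ?m]) (auto intro!: sum.cong)
    show ?thesis
      by (simp only: *) (simp only: r, simp add: algebra_simps)
  qed
  have "(\<integral>\<^sup>+x. f (x + (c * x $ n) *\<^sub>R ?m) \<partial>lborel) =
      (\<integral>\<^sup>+y. (\<integral>\<^sup>+t. f (?v (y(?m := c * y ?n + 1 * t))) \<partial>lborel) \<partial>(\<Pi>\<^sub>M b\<in>?B - {?m}. lborel))"
    by (subst split) (simp_all only: shift, measurable)
  also have "\<dots> = (\<integral>\<^sup>+y. (\<integral>\<^sup>+t. f (?v (y(?m := t))) \<partial>lborel) \<partial>(\<Pi>\<^sub>M b\<in>?B - {?m}. lborel))"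
  proof (rule nn_integral_cong)
    fix y :: "real ^ 'n \<Rightarrow> real"
    have "(\<lambda>t. ?v (y(?m := t))) = (\<lambda>t. t *\<^sub>R ?m + (\<Sum>b\<in>?B - {?m}. y b *\<^sub>R b))"
      using mB by (intro ext, subst sum.remove[of _ ?m]) (auto intro!: sum.cong)
    then have [measurable]: "(\<lambda>t. f (?v (y(?m := t)))) \<in> borel_measurable borel"
      by simp
    show "(\<integral>\<^sup>+t. f (?v (y(?m := c * y ?n + 1 * t))) \<partial>lborel) = (\<integral>\<^sup>+t. f (?v (y(?m := t))) \<partial>lborel)"
      by (subst (2) nn_integral_real_affine[where c=1 and t="c * y ?n"]) simp_all
  qed
  also have "\<dots> = (\<integral>\<^sup>+x. f x \<partial>lborel)"
    by (subst split) simp_all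
  finally show ?thesis .
qed

lemma nn_integral_permute_coordinates:
  fixes f :: "real ^ 'n \<Rightarrow> ennreal" and p :: "'n \<Rightarrow> 'n"
  assumes [measurable]: "f \<in> borel_measurable borel" and p: "bij p"
  shows "(\<integral>\<^sup>+x. f (\<chi> i. x $ p i) \<partial>lborel) = (\<integral>\<^sup>+x. f x \<partial>lborel)"
proof -
  let ?T = "\<lambda>x::real ^ 'n. \<chi> i. x $ p i"
  have [measurable]: "?T \<in> borel_measurable borel"
    by (intro borel_measurable_continuous_onI continuous_on_vec_lambda continuous_intros)
  have "lborel = distr lborel borel ?T"
  proof (rule lborel_eqI)
    fix l u :: "real ^ 'n" assume le: "\<And>b. b \<in> Basis \<Longrightarrow> l \<bullet> b \<le> u \<bullet> b"
    let ?l = "\<chi> i. l $ inv p i" and ?u = "\<chi> i. u $ inv p i"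
    have le': "l $ i \<le> u $ i" for i
      using le[of "axis i 1"] by (simp add: inner_axis)
    have "?T -` box l u = box ?l ?u"
    proof -
      have "(\<forall>i. l $ i < x $ p i \<and> x $ p i < u $ i) \<longleftrightarrow>
          (\<forall>i. l $ inv p i < x $ i \<and> x $ i < u $ inv p i)" for x
        using p by (metis bij_inv_eq_iff)
      then show ?thesis
        by (auto simp: mem_box_cart)
    qed
    then have "emeasure (distr lborel borel ?T) (box l u) = emeasure lborel (box ?l ?u)"
      by (simp add: emeasure_distr)
    also have "\<dots> = (\<Prod>b\<in>Basis. (?u - ?l) \<bullet> b)"
      using le' by (subst emeasure_lborel_box) (auto simp: Basis_vec_def inner_axis)
    also have "(\<Prod>b\<in>Basis. (?u - ?l) \<bullet> b) = (\<Prod>i\<in>UNIV. (u - l) $ inv p i)"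
      by (simp add: Basis_vec_def UNION_singleton_eq_range prod.reindex inj_on_def axis_eq_axis inner_axis)
    also have "\<dots> = (\<Prod>i\<in>UNIV. (u - l) $ i)"
      using p by (intro prod.reindex_bij_betw bij_imp_bij_inv)
    also have "\<dots> = (\<Prod>b\<in>Basis. (u - l) \<bullet> b)"
      by (simp add: Basis_vec_def UNION_singleton_eq_range prod.reindex inj_on_def axis_eq_axis inner_axis)
    finally show "emeasure (distr lborel borel ?T) (box l u) = (\<Prod>b\<in>Basis. (u - l) \<bullet> b)" .
  qed simp
  then have "(\<integral>\<^sup>+x. f x \<partial>lborel) = (\<integral>\<^sup>+x. f x \<partial>distr lborel borel ?T)"
    by simp
  then show ?thesis
    by (simp add: nn_integral_distr)
qed

text \<open>The claim passes from two matrices to their product, so it suffices to treat diagonal matrices,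
  permutations of coordinates and shears. Elementary matrices work for every finite index type, whereas a triangular
  decomposition would need an order on the indices.\<close>

lemma nn_integral_matrix:
  fixes A :: "real ^ 'n ^ 'n"
  assumes "det A \<noteq> 0" and "f \<in> borel_measurable borel"
  shows "(\<integral>\<^sup>+x. f (A *v x) \<partial>lborel) * ennreal \<bar>det A\<bar> = (\<integral>\<^sup>+x. f x \<partial>lborel)"
proof -
  have "det A \<noteq> 0 \<longrightarrow> (\<forall>f\<in>borel_measurable borel.
      (\<integral>\<^sup>+x. f (A *v x) \<partial>lborel) * ennreal \<bar>det A\<bar> = (\<integral>\<^sup>+x. f x \<partial>lborel))" (is "?P A")
  proof (rule induct_matrix_elementary[of ?P])
    fix A B :: "real ^ 'n ^ 'n"
    assume A: "?P A" and B: "?P B"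
    show "?P (A ** B)"
    proof (intro impI ballI)
      fix f :: "real ^ 'n \<Rightarrow> ennreal"
      assume d: "det (A ** B) \<noteq> 0" and [measurable]: "f \<in> borel_measurable borel"
      then have nz: "det A \<noteq> 0" "det B \<noteq> 0"
        by (auto simp: det_mul)
      have [measurable]: "(*v) A \<in> borel_measurable borel"
        by (intro borel_measurable_continuous_onI continuous_intros)
      have "(\<integral>\<^sup>+x. f ((A ** B) *v x) \<partial>lborel) * ennreal \<bar>det (A ** B)\<bar> =
         (\<integral>\<^sup>+x. f (A *v (B *v x)) \<partial>lborel) * ennreal \<bar>det B\<bar> * ennreal \<bar>det A\<bar>"
        by (simp add: det_mul abs_mult matrix_vector_mul_assoc ennreal_mult' ac_simps)
      also have "(\<integral>\<^sup>+x. f (A *v (B *v x)) \<partial>lborel) * ennreal \<bar>det B\<bar> = (\<integral>\<^sup>+x. f (A *v x) \<partial>lborel)"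
        using B nz(2) by (auto dest!: bspec[where x="\<lambda>x. f (A *v x)"])
      also have "\<dots> * ennreal \<bar>det A\<bar> = (\<integral>\<^sup>+x. f x \<partial>lborel)"
        using A nz(1) by auto
      finally show "(\<integral>\<^sup>+x. f ((A ** B) *v x) \<partial>lborel) * ennreal \<bar>det (A ** B)\<bar> = (\<integral>\<^sup>+x. f x \<partial>lborel)" .
    qed
  next
    fix A :: "real ^ 'n ^ 'n" and i
    assume "row i A = 0"
    then show "?P A"
      by (simp add: det_zero_row)
  next
    fix A :: "real ^ 'n ^ 'n"
    assume diag: "\<And>i j. i \<noteq> j \<Longrightarrow> A $ i $ j = 0"
    show "?P A"
    proof (intro impI ballI)
      fix f :: "real ^ 'n \<Rightarrow> ennreal"
      assume d: "det A \<noteq> 0" and [measurable]: "f \<in> borel_measurable borel"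
      have det: "det A = (\<Prod>i\<in>UNIV. A $ i $ i)"
        by (rule det_diagonal) (rule diag)
      let ?c = "\<lambda>j::real ^ 'n. (A *v j) \<bullet> j"
      have c: "?c (axis i 1) = A $ i $ i" for i
        by (simp add: inner_axis matrix_vector_mult_basis column_def)
      have prod: "(\<Prod>j\<in>Basis. \<bar>?c j\<bar>) = \<bar>det A\<bar>"
        by (simp add: Basis_vec_def UNION_singleton_eq_range prod.reindex inj_on_def axis_eq_axis c
            det abs_prod)
      have T: "(\<Sum>j\<in>Basis. (?c j * (x \<bullet> j)) *\<^sub>R j) = A *v x" for x
      proof -
        have "(\<Sum>j\<in>Basis. (?c j * (x \<bullet> j)) *\<^sub>R j) $ k = A $ k $ k * x $ k" for k
        proof -
          have "(\<Sum>j\<in>Basis. (?c j * (x \<bullet> j)) *\<^sub>R j) $ k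
              = (\<Sum>j\<in>Basis. (?c j * (x \<bullet> j)) *\<^sub>R j) \<bullet> axis k 1"
            by (simp add: inner_axis)
          also have "\<dots> = ?c (axis k 1) * (x \<bullet> axis k 1)"
            by (rule inner_sum_left_Basis) simp
          finally show ?thesis
            by (simp add: c) (simp add: inner_axis)
        qed
        moreover have "(A *v x) $ k = A $ k $ k * x $ k" for k
          unfolding matrix_vector_mult_def
          by (simp, subst sum.remove[of _ k]) (auto simp: diag intro!: sum.neutral)
        ultimately show ?thesis
          by (simp add: vec_eq_iff)
      qed
      have "?c j \<noteq> 0" if "j \<in> Basis" for j
        using d that by (auto simp: Basis_vec_def c det)
      from lborel_affine_euclidean[of ?c 0, OF this]
      have "lborel = density (distr lborel borel (\<lambda>x. A *v x)) (\<lambda>_. ennreal \<bar>det A\<bar>)"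
        by (simp add: T prod)
      then have "(\<integral>\<^sup>+x. f x \<partial>lborel) =
          (\<integral>\<^sup>+x. f x \<partial>density (distr lborel borel (\<lambda>x. A *v x)) (\<lambda>_. ennreal \<bar>det A\<bar>))"
        by simp
      also have "\<dots> = (\<integral>\<^sup>+x. f (A *v x) \<partial>lborel) * ennreal \<bar>det A\<bar>"
      proof -
        have [measurable]: "(*v) A \<in> borel_measurable borel"
          by (intro borel_measurable_continuous_onI continuous_intros)
        show ?thesis
          by (simp add: nn_integral_density nn_integral_distr nn_integral_cmult ac_simps)
      qed
      finally show "(\<integral>\<^sup>+x. f (A *v x) \<partial>lborel) * ennreal \<bar>det A\<bar> = (\<integral>\<^sup>+x. f x \<partial>lborel)"
        by simp
    qed
  next
    fix m n :: 'n assume mn: "m \<noteq> n"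
    let ?S = "\<chi> i j. mat 1 $ i $ Transposition.transpose m n j :: real ^ 'n ^ 'n"
    have S: "?S *v x = (\<chi> i. x $ Transposition.transpose m n i)" for x
    proof -
      have "(\<Sum>j\<in>UNIV. ?S $ i $ j * x $ j) = x $ Transposition.transpose m n i" for i
      proof -
        have "(\<Sum>j\<in>UNIV. ?S $ i $ j * x $ j) =
            (\<Sum>j\<in>UNIV. if j = Transposition.transpose m n i then x $ j else 0)"
          by (intro sum.cong refl) (auto simp: mat_def)
        then show ?thesis by simp
      qed
      then show ?thesis
        by (simp add: matrix_vector_mult_def vec_eq_iff)
    qed
    have "\<bar>det ?S\<bar> = 1"
    proof -
      have "det ?S = of_int (sign (Transposition.transpose m n)) * det (mat 1 :: real ^ 'n ^ 'n)"
        by (rule det_permute_columns) (simp add: permutes_swap_id)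
      then show ?thesis
        using mn by (simp add: sign_swap_id)
    qed
    then show "?P ?S"
      using nn_integral_permute_coordinates[of _ "Transposition.transpose m n"] by (simp add: S)
  next
    fix m n :: 'n and c :: real assume mn: "m \<noteq> n"
    let ?S = "\<chi> i j. if i = m \<and> j = n then c else of_bool (i = j) :: real ^ 'n ^ 'n"
    have S: "?S *v x = x + (c * x $ n) *\<^sub>R axis m 1" for x
    proof -
      have "(\<Sum>j\<in>UNIV. ?S $ i $ j * x $ j) = x $ i + c * x $ n * (axis m 1 :: real ^ 'n) $ i" for i
      proof -
        have "(\<Sum>j\<in>UNIV. ?S $ i $ j * x $ j) =
            (\<Sum>j\<in>UNIV. (if j = i then x $ j else 0) + (if j = n then (if i = m then c * x $ n else 0) else 0))"
          using mn by (intro sum.cong refl) auto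
        then show ?thesis by (simp add: sum.distrib axis_def)
      qed
      then show ?thesis
        by (simp add: matrix_vector_mult_def vec_eq_iff)
    qed
    have "det ?S = 1"
    proof -
      have "?S = (\<chi> k. if k = m then row m (mat 1) + c *s row n (mat 1) else row k (mat 1))"
        using mn by (auto simp: vec_eq_iff row_def mat_def)
      then show ?thesis
        using det_row_operation[OF mn, of "mat 1" c] by simp
    qed
    then show "?P ?S"
      using nn_integral_shear[OF _ mn] by (simp add: S)
  qed
  with assms show ?thesis by blast
qed

section \<open>Gaussians and Fourier inversion\<close>

lemma integral_lborel_affine:
  fixes f :: "'a::euclidean_space \<Rightarrow> 'b::{banach, second_countable_topology}"
  assumes [measurable]: "f \<in> borel_measurable borel" and c: "c \<noteq> 0"
  shows "(\<integral>x. f x \<partial>lborel) = \<bar>c\<bar> ^ DIM('a) *\<^sub>R (\<integral>x. f (t + c *\<^sub>R x) \<partial>lborel)"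
  by (subst lborel_affine[OF c, of t]) (simp add: integral_density integral_distr)

lemma integrable_lborel_affine:
  fixes f :: "'a::euclidean_space \<Rightarrow> 'b::{banach, second_countable_topology}"
  assumes f: "integrable lborel f" and c: "c \<noteq> 0"
  shows "integrable lborel (\<lambda>x. f (t + c *\<^sub>R x))"
proof -
  have [measurable]: "f \<in> borel_measurable borel"
    using f by auto
  have "integrable (density (distr lborel borel (\<lambda>x. t + c *\<^sub>R x)) (\<lambda>_. ennreal (\<bar>c\<bar> ^ DIM('a)))) f"
    using f by (subst (asm) lborel_affine[OF c, of t])
      (simp add: ennreal_power)
  then have "integrable lborel (\<lambda>x. \<bar>c\<bar> ^ DIM('a) *\<^sub>R f (t + c *\<^sub>R x))"
    by (subst (asm) integrable_density) (simp_all add: integrable_distr_eq)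
  then have "integrable lborel (\<lambda>x. inverse (\<bar>c\<bar> ^ DIM('a)) *\<^sub>R (\<bar>c\<bar> ^ DIM('a) *\<^sub>R f (t + c *\<^sub>R x)))"
    by - (rule integrable_scaleR_right)
  moreover have "inverse (\<bar>c\<bar> ^ DIM('a)) *\<^sub>R (\<bar>c\<bar> ^ DIM('a) *\<^sub>R f (t + c *\<^sub>R x)) = f (t + c *\<^sub>R x)" for x
    using c by simp
  ultimately show ?thesis
    by (simp only:)
qed

lemma integral_lborel_prod:
  fixes f :: "'a::euclidean_space \<Rightarrow> real \<Rightarrow> complex"
  assumes f: "\<And>b. b \<in> Basis \<Longrightarrow> integrable lborel (f b)"
  shows "integrable lborel (\<lambda>x. \<Prod>b\<in>Basis. f b (x \<bullet> b))" (is ?int)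
    and "(\<integral>x. (\<Prod>b\<in>Basis. f b (x \<bullet> b)) \<partial>lborel) = (\<Prod>b\<in>Basis. integral\<^sup>L lborel (f b))" (is ?eq)
proof -
  interpret product_sigma_finite "\<lambda>_. lborel :: real measure" ..
  have [measurable]: "f b \<in> borel_measurable borel" if "b \<in> Basis" for b
    using f[OF that] by auto
  have eq: "(\<Prod>b\<in>Basis. f b ((\<Sum>b\<in>Basis. y b *\<^sub>R b) \<bullet> b)) = (\<Prod>b\<in>Basis. f b (y b))" for y :: "'a \<Rightarrow> real"
    by (intro prod.cong refl) (simp add: inner_sum_left_Basis)
  show ?int
    by (subst lborel_eq) (simp add: integrable_distr_eq eq product_integrable_prod f)
  show ?eq
    by (subst lborel_eq) (simp add: integral_distr eq product_integral_prod f)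
qed

lemma gaussian_fourier_real:
  shows "integrable lborel (\<lambda>y. exp (\<i> * complex_of_real (t * y)) * complex_of_real (exp (- (y\<^sup>2 / 2))))" (is ?int)
    and "(\<integral>y. exp (\<i> * complex_of_real (t * y)) * complex_of_real (exp (- (y\<^sup>2 / 2))) \<partial>lborel)
      = complex_of_real (sqrt (2 * pi) * exp (- (t\<^sup>2 / 2)))" (is ?eq)
proof -
  have eq: "exp (\<i> * complex_of_real (t * y)) * complex_of_real (exp (- (y\<^sup>2 / 2))) =
      complex_of_real (sqrt (2 * pi)) * (std_normal_density y *\<^sub>R exp (\<i> * complex_of_real (t * y)))" for y
    by (simp add: std_normal_density_def scaleR_conv_of_real real_sqrt_mult)
  have "integrable lborel (\<lambda>y. complex_of_real (std_normal_density y))"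
    by (intro integrable_of_real) simp
  then have "integrable lborel (\<lambda>y. std_normal_density y *\<^sub>R exp (\<i> * complex_of_real (t * y)))"
    by (rule Bochner_Integration.integrable_bound) (auto simp: norm_mult)
  then show ?int
    unfolding eq by (intro integrable_mult_right)
  have "(\<integral>y. std_normal_density y *\<^sub>R exp (\<i> * complex_of_real (t * y)) \<partial>lborel)
      = char std_normal_distribution t"
    unfolding char_def by (subst integral_density) auto
  also have "\<dots> = complex_of_real (exp (- (t\<^sup>2 / 2)))"
    by (simp add: char_std_normal_distribution)
  finally have val: "(\<integral>y. std_normal_density y *\<^sub>R exp (\<i> * complex_of_real (t * y)) \<partial>lborel)
      = complex_of_real (exp (- (t\<^sup>2 / 2)))" .
  show ?eq
    unfolding eq integral_mult_right_zero val by simp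
qed

lemma gaussian_fourier_scaled:
  assumes k: "k > 0"
  shows "integrable lborel (\<lambda>y. exp (\<i> * complex_of_real (t * y)) * complex_of_real (exp (- ((y / k)\<^sup>2 / 2))))" (is ?int)
    and "(\<integral>y. exp (\<i> * complex_of_real (t * y)) * complex_of_real (exp (- ((y / k)\<^sup>2 / 2))) \<partial>lborel)
      = complex_of_real (k * sqrt (2 * pi) * exp (- ((k * t)\<^sup>2 / 2)))" (is ?eq)
proof -
  let ?f = "\<lambda>y. exp (\<i> * complex_of_real (t * y)) * complex_of_real (exp (- ((y / k)\<^sup>2 / 2)))"
  have eq: "?f (0 + k * y) = exp (\<i> * complex_of_real ((k * t) * y)) * complex_of_real (exp (- (y\<^sup>2 / 2)))" for y
    using k by (simp add: ac_simps)
  show ?int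
    using lborel_integrable_real_affine_iff[of k ?f 0] gaussian_fourier_real(1)[of "k * t"] k
    by (simp only: eq)
  show ?eq
    using lborel_integral_real_affine[of k ?f 0] gaussian_fourier_real(2)[of "k * t"] k
    by (simp only: eq) (simp add: scaleR_conv_of_real)
qed

lemma gaussian_fourier:
  fixes w :: "'a::euclidean_space"
  assumes k: "k > 0"
  shows "integrable lborel (\<lambda>y::'a. exp (\<i> * complex_of_real (w \<bullet> y)) * complex_of_real (exp (- ((norm y / k)\<^sup>2 / 2))))" (is ?int)
    and "(\<integral>y. exp (\<i> * complex_of_real (w \<bullet> y)) * complex_of_real (exp (- ((norm y / k)\<^sup>2 / 2))) \<partial>lborel)
      = complex_of_real ((k * sqrt (2 * pi)) ^ DIM('a) * exp (- ((k * norm w)\<^sup>2 / 2)))" (is ?eq)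
proof -
  let ?f = "\<lambda>b y. exp (\<i> * complex_of_real ((w \<bullet> b) * y)) * complex_of_real (exp (- ((y / k)\<^sup>2 / 2)))"
  have norm_sq: "(norm y)\<^sup>2 = (\<Sum>b\<in>Basis. (y \<bullet> b)\<^sup>2)" for y :: 'a
    unfolding power2_norm_eq_inner by (subst euclidean_inner) (simp add: power2_eq_square)
  have prod: "(\<Prod>b\<in>Basis. ?f b (y \<bullet> b)) =
      exp (\<i> * complex_of_real (w \<bullet> y)) * complex_of_real (exp (- ((norm y / k)\<^sup>2 / 2)))" for y :: 'a
  proof -
    have "w \<bullet> y = (\<Sum>b\<in>Basis. (w \<bullet> b) * (y \<bullet> b))"
      by (rule euclidean_inner)
    then have 1: "exp (\<i> * complex_of_real (w \<bullet> y)) = (\<Prod>b\<in>Basis. exp (\<i> * complex_of_real ((w \<bullet> b) * (y \<bullet> b))))"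
      by (simp add: exp_sum[symmetric] sum_distrib_left)
    have "- ((norm y / k)\<^sup>2 / 2) = (\<Sum>b\<in>Basis. - ((y \<bullet> b / k)\<^sup>2 / 2))"
      by (simp add: power_divide norm_sq sum_negf sum_divide_distrib)
    then have 2: "exp (- ((norm y / k)\<^sup>2 / 2)) = (\<Prod>b\<in>Basis. exp (- ((y \<bullet> b / k)\<^sup>2 / 2)))"
      by (simp add: exp_sum[symmetric])
    show ?thesis
      unfolding 1 2 of_real_prod prod.distrib ..
  qed
  note prod_int = integral_lborel_prod[of ?f, OF gaussian_fourier_scaled(1)[OF k]]
  show ?int
    using prod_int(1) by (simp only: prod)
  have "(\<integral>y. exp (\<i> * complex_of_real (w \<bullet> y)) * complex_of_real (exp (- ((norm y / k)\<^sup>2 / 2))) \<partial>lborel)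
      = (\<Prod>b\<in>Basis. complex_of_real (k * sqrt (2 * pi) * exp (- ((k * (w \<bullet> b))\<^sup>2 / 2))))"
    using prod_int(2) by (simp only: prod gaussian_fourier_scaled(2)[OF k])
  also have "\<dots> = complex_of_real (\<Prod>b\<in>Basis. k * sqrt (2 * pi) * exp (- ((k * (w \<bullet> b))\<^sup>2 / 2)))"
    by simp
  also have "(\<Prod>b\<in>Basis. k * sqrt (2 * pi) * exp (- ((k * (w \<bullet> b))\<^sup>2 / 2))) =
      (k * sqrt (2 * pi)) ^ DIM('a) * exp (\<Sum>b\<in>Basis. - ((k * (w \<bullet> b))\<^sup>2 / 2))"
    by (simp add: prod.distrib exp_sum power_mult_distrib)
  also have "(\<Sum>b\<in>Basis. - ((k * (w \<bullet> b))\<^sup>2 / 2)) = - ((k * norm w)\<^sup>2 / 2)"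
    by (simp add: power_mult_distrib norm_sq sum_negf sum_divide_distrib sum_distrib_left)
  finally show ?eq .
qed

lemma gaussian_integral:
  shows "integrable lborel (\<lambda>y::'a::euclidean_space. exp (- ((norm y)\<^sup>2 / 2)))" (is ?int)
    and "(\<integral>y. exp (- ((norm (y::'a))\<^sup>2 / 2)) \<partial>lborel) = sqrt (2 * pi) ^ DIM('a)" (is ?eq)
proof -
  have "integrable lborel (\<lambda>y::'a. complex_of_real (exp (- ((norm y)\<^sup>2 / 2))))"
    using gaussian_fourier(1)[of 1 "0::'a"] by simp
  then show ?int
    by (simp only: complex_of_real_integrable_eq)
  have "complex_of_real (\<integral>y. exp (- ((norm (y::'a))\<^sup>2 / 2)) \<partial>lborel) = complex_of_real (sqrt (2 * pi) ^ DIM('a))"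
    using gaussian_fourier(2)[of 1 "0::'a"] by (simp del: of_real_power of_real_exp add: integral_complex_of_real)
  then show ?eq
    by (simp only: of_real_eq_iff)
qed

text \<open>Substituting \<open>u = v / (k + 1)\<close> turns the integrand into \<open>h (v / (k + 1))\<close> times a fixed Gaussian, and
  dominated convergence applies.\<close>

lemma gaussian_approximate_identity:
  fixes h :: "'a::euclidean_space \<Rightarrow> complex"
  assumes [measurable]: "h \<in> borel_measurable borel"
    and bounded: "\<And>u. norm (h u) \<le> C" and cont: "isCont h 0"
  shows "(\<lambda>k::nat. \<integral>u. h u * complex_of_real (real (Suc k) ^ DIM('a) * exp (- ((real (Suc k) * norm u)\<^sup>2 / 2))) \<partial>lborel)
    \<longlonglongrightarrow> h 0 * complex_of_real (sqrt (2 * pi) ^ DIM('a))"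
proof -
  let ?g = "\<lambda>v::'a. exp (- ((norm v)\<^sup>2 / 2))"
  have scale: "(\<integral>u. h u * complex_of_real (real (Suc k) ^ DIM('a) * exp (- ((real (Suc k) * norm u)\<^sup>2 / 2))) \<partial>lborel)
      = (\<integral>v. h (inverse (real (Suc k)) *\<^sub>R v) * complex_of_real (?g v) \<partial>lborel)" for k
  proof -
    have "(\<integral>u. h u * complex_of_real (real (Suc k) ^ DIM('a) * exp (- ((real (Suc k) * norm u)\<^sup>2 / 2))) \<partial>lborel)
      = \<bar>inverse (real (Suc k))\<bar> ^ DIM('a) *\<^sub>R (\<integral>v. h (0 + inverse (real (Suc k)) *\<^sub>R v) *
          complex_of_real (real (Suc k) ^ DIM('a) * exp (- ((real (Suc k) * norm (0 + inverse (real (Suc k)) *\<^sub>R v))\<^sup>2 / 2))) \<partial>lborel)"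
      by (rule integral_lborel_affine) auto
    also have "\<dots> = (\<integral>v. h (inverse (real (Suc k)) *\<^sub>R v) * complex_of_real (?g v) \<partial>lborel)"
      by (simp add: scaleR_conv_of_real integral_mult_right_zero[symmetric] del: of_nat_Suc integral_mult_right_zero)
         (simp add: field_simps power_mult_distrib[symmetric] del: of_nat_Suc)
    finally show ?thesis .
  qed
  have "(\<lambda>k::nat. \<integral>v. h (inverse (real (Suc k)) *\<^sub>R v) * complex_of_real (?g v) \<partial>lborel)
      \<longlonglongrightarrow> (\<integral>v. h 0 * complex_of_real (?g v) \<partial>lborel)"
  proof (rule integral_dominated_convergence[where w="\<lambda>v. C * ?g v"])
    show "integrable lborel (\<lambda>v. C * ?g v)"
      by (intro integrable_mult_right gaussian_integral(1))
    show "AE v in lborel. (\<lambda>k::nat. h (inverse (real (Suc k)) *\<^sub>R v) * complex_of_real (?g v)) \<longlonglongrightarrow> h 0 * complex_of_real (?g v)"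
    proof (intro AE_I2 tendsto_mult tendsto_const)
      fix v :: 'a
      have "(\<lambda>k. inverse (real (Suc k)) *\<^sub>R v) \<longlonglongrightarrow> 0 *\<^sub>R v"
        by (intro tendsto_scaleR tendsto_const LIMSEQ_inverse_real_of_nat)
      then show "(\<lambda>k. h (inverse (real (Suc k)) *\<^sub>R v)) \<longlonglongrightarrow> h 0"
        by (intro isCont_tendsto_compose[OF cont]) simp
    qed
    show "AE v in lborel. norm (h (inverse (real (Suc k)) *\<^sub>R v) * complex_of_real (?g v)) \<le> C * ?g v" for k
      using bounded by (auto simp: norm_mult intro!: mult_right_mono)
  qed auto
  also have "(\<integral>v. h 0 * complex_of_real (?g v) \<partial>lborel) = h 0 * complex_of_real (sqrt (2 * pi) ^ DIM('a))"
    by (simp only: integral_mult_right_zero integral_complex_of_real gaussian_integral(2))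
  finally show ?thesis
    by (simp only: scale)
qed

text \<open>Complements the previous lemma: a function that is merely integrable need not be bounded, but
  outside the unit ball the narrowing Gaussians tend to zero uniformly.\<close>

lemma gaussian_away_from_origin:
  fixes h :: "'a::euclidean_space \<Rightarrow> complex"
  assumes h: "integrable lborel h" and vanish: "\<And>u. norm u < 1 \<Longrightarrow> h u = 0"
  shows "(\<lambda>k::nat. \<integral>u. h u * complex_of_real (real (Suc k) ^ DIM('a) * exp (- ((real (Suc k) * norm u)\<^sup>2 / 2))) \<partial>lborel)
    \<longlonglongrightarrow> 0"
proof (rule Lim_null_comparison)
  let ?B = "\<lambda>k::nat. exp 1 * (real (Suc k) ^ DIM('a) / exp (real (Suc k))) * (\<integral>u. norm (h u) \<partial>lborel)"
  have [measurable]: "h \<in> borel_measurable borel"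
    using h by auto
  have "norm (\<integral>u. h u * complex_of_real (real (Suc k) ^ DIM('a) * exp (- ((real (Suc k) * norm u)\<^sup>2 / 2))) \<partial>lborel) \<le> ?B k" for k
  proof -
    let ?c = "exp 1 * (real (Suc k) ^ DIM('a) / exp (real (Suc k)))"
    have bound: "norm (h u * complex_of_real (real (Suc k) ^ DIM('a) * exp (- ((real (Suc k) * norm u)\<^sup>2 / 2))))
        \<le> ?c * norm (h u)" for u
    proof (cases "norm u < 1")
      case True
      then show ?thesis using vanish by simp
    next
      case False
      let ?t = "real (Suc k) * norm u"
      \<comment> \<open>with \<open>t \<ge> k + 1\<close> the bound \<open>t\<^sup>2 / 2 \<ge> t - 1 / 2\<close> replaces the Gaussian by an exponential\<close>
      have "real (Suc k) \<le> ?t"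
        using False by simp
      moreover have "2 * ?t \<le> ?t\<^sup>2 + 1"
        using sum_squares_bound[of ?t 1] by simp
      ultimately have "- (?t\<^sup>2 / 2) \<le> 1 - real (Suc k)"
        by argo
      then have "exp (- (?t\<^sup>2 / 2)) \<le> exp 1 / exp (real (Suc k))"
        by (simp add: exp_diff[symmetric])
      then have "real (Suc k) ^ DIM('a) * exp (- (?t\<^sup>2 / 2)) \<le> real (Suc k) ^ DIM('a) * (exp 1 / exp (real (Suc k)))"
        by (intro mult_left_mono) auto
      then have "real (Suc k) ^ DIM('a) * exp (- (?t\<^sup>2 / 2)) \<le> ?c"
        by (simp only: ac_simps times_divide_eq_right times_divide_eq_left)
      then have "norm (h u) * (real (Suc k) ^ DIM('a) * exp (- (?t\<^sup>2 / 2))) \<le> norm (h u) * ?c"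
        by (intro mult_left_mono) auto
      moreover have "norm (h u * complex_of_real (real (Suc k) ^ DIM('a) * exp (- (?t\<^sup>2 / 2)))) =
          norm (h u) * (real (Suc k) ^ DIM('a) * exp (- (?t\<^sup>2 / 2)))"
        unfolding norm_mult norm_of_real by (simp del: of_nat_Suc)
      ultimately show ?thesis
        by (simp only: mult.commute)
    qed
    have "norm (\<integral>u. h u * complex_of_real (real (Suc k) ^ DIM('a) * exp (- ((real (Suc k) * norm u)\<^sup>2 / 2))) \<partial>lborel)
        \<le> (\<integral>u. ?c * norm (h u) \<partial>lborel)"
    proof (rule Bochner_Integration.integral_norm_bound_integral)
      show int: "integrable lborel (\<lambda>u. ?c * norm (h u))"
        using h by auto
      show "integrable lborel (\<lambda>u. h u * complex_of_real (real (Suc k) ^ DIM('a) * exp (- ((real (Suc k) * norm u)\<^sup>2 / 2))))"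
      proof (rule Bochner_Integration.integrable_bound[OF int])
        show "AE u in lborel. norm (h u * complex_of_real (real (Suc k) ^ DIM('a) * exp (- ((real (Suc k) * norm u)\<^sup>2 / 2))))
          \<le> norm (?c * norm (h u))"
          using bound by (intro AE_I2) (metis abs_ge_self order_trans real_norm_def)
      qed auto
    qed (rule bound)
    then show ?thesis
      by simp
  qed
  then show "\<forall>\<^sub>F k in sequentially. norm (\<integral>u. h u * complex_of_real (real (Suc k) ^ DIM('a) * exp (- ((real (Suc k) * norm u)\<^sup>2 / 2))) \<partial>lborel) \<le> ?B k"
    by (intro always_eventually allI)
  have "(\<lambda>k. real k ^ DIM('a) / exp (real k)) \<longlonglongrightarrow> 0"
    by (rule filterlim_compose[OF tendsto_power_div_exp_0 filterlim_real_sequentially])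
  then have "(\<lambda>k. real (Suc k) ^ DIM('a) / exp (real (Suc k))) \<longlonglongrightarrow> 0"
    by (rule LIMSEQ_Suc)
  from tendsto_mult[OF tendsto_mult[OF tendsto_const this] tendsto_const]
  show "?B \<longlonglongrightarrow> 0"
    by (simp only: mult_zero_left mult_zero_right)
qed

lemma fourier_lborel:
  fixes f :: "real ^ 'n \<Rightarrow> complex"
  assumes [measurable]: "f \<in> borel_measurable borel"
  shows "fourier f y = (\<integral>x. exp (- \<i> * complex_of_real (x \<bullet> y)) * f x \<partial>lborel)"
  unfolding fourier_def by (rule integral_completion) measurable

lemma isCont_fourier:
  fixes f :: "real ^ 'n \<Rightarrow> complex"
  assumes f: "integrable lborel f"
  shows "isCont (fourier f) y"
proof -
  have [measurable]: "f \<in> borel_measurable borel"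
    using f by auto
  have "(\<lambda>n. fourier f (X n)) \<longlonglongrightarrow> fourier f y" if X: "X \<longlonglongrightarrow> y" for X
    unfolding fourier_lborel[OF \<open>f \<in> borel_measurable borel\<close>]
  proof (rule integral_dominated_convergence[where w="\<lambda>x. norm (f x)"])
    show "AE x in lborel. (\<lambda>n. exp (- \<i> * complex_of_real (x \<bullet> X n)) * f x) \<longlonglongrightarrow>
        exp (- \<i> * complex_of_real (x \<bullet> y)) * f x"
      using X by (intro AE_I2 tendsto_intros)
  qed (use f in \<open>auto simp: norm_mult\<close>)
  then show ?thesis
    by (auto simp: continuous_at_sequentially o_def)
qed

lemma borel_measurable_fourier:
  fixes f :: "real ^ 'n \<Rightarrow> complex"
  assumes f: "integrable lborel f"
  shows "fourier f \<in> borel_measurable borel"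
  using isCont_fourier[OF f] by (intro borel_measurable_continuous_onI continuous_at_imp_continuous_on) auto

text \<open>A factor \<open>exp (- (norm y / (k + 1))\<^sup>2 / 2)\<close> makes the double integral absolutely convergent, so
  that Fubini's theorem rewrites the inverse transform as the convolution of \<open>f\<close> with a narrow
  Gaussian. As \<open>k\<close> grows the factor disappears on the transform side by dominated convergence. On the
  other side \<open>f\<close> is split at the unit ball around \<open>x\<close>: near \<open>x\<close> it is bounded and continuous and the
  Gaussians act as an approximate identity, and the rest contributes nothing in the limit.\<close>

theorem fourier_inversion:
  fixes f :: "real ^ 'n \<Rightarrow> complex"
  assumes cont: "continuous_on UNIV f" and f: "integrable lborel f" and Ff: "integrable lborel (fourier f)"
  shows "(\<integral>y. fourier f y * exp (\<i> * complex_of_real (y \<bullet> x)) \<partial>lborel) = complex_of_real ((2 * pi) ^ CARD('n)) * f x"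
proof (rule LIMSEQ_unique)
  let ?n = "CARD('n)"
  let ?G = "\<lambda>k::nat. \<lambda>y::real ^ 'n. complex_of_real (exp (- ((norm y / real (Suc k))\<^sup>2 / 2)))"
  let ?H = "\<lambda>k::nat. \<lambda>u::real ^ 'n. complex_of_real (real (Suc k) ^ DIM(real ^ 'n) * exp (- ((real (Suc k) * norm u)\<^sup>2 / 2)))"
  let ?c = "complex_of_real (sqrt (2 * pi) ^ ?n)"
  let ?L = "\<lambda>k. \<integral>y. fourier f y * exp (\<i> * complex_of_real (y \<bullet> x)) * ?G k y \<partial>lborel"
  note [measurable] = borel_measurable_continuous_onI[OF cont] borel_measurable_fourier[OF f]
  show "?L \<longlonglongrightarrow> (\<integral>y. fourier f y * exp (\<i> * complex_of_real (y \<bullet> x)) \<partial>lborel)"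
  proof (rule integral_dominated_convergence[where w="\<lambda>y. norm (fourier f y)"])
    show "AE y in lborel. (\<lambda>k. fourier f y * exp (\<i> * complex_of_real (y \<bullet> x)) * ?G k y) \<longlonglongrightarrow>
        fourier f y * exp (\<i> * complex_of_real (y \<bullet> x))"
    proof (rule AE_I2)
      fix y :: "real ^ 'n"
      have "(\<lambda>k. norm y * inverse (real (Suc k))) \<longlonglongrightarrow> norm y * 0"
        by (intro tendsto_mult tendsto_const LIMSEQ_inverse_real_of_nat)
      then have *: "(\<lambda>k. norm y / real (Suc k)) \<longlonglongrightarrow> 0"
        by (simp add: divide_inverse)
      have "(\<lambda>k. fourier f y * exp (\<i> * complex_of_real (y \<bullet> x)) * ?G k y) \<longlonglongrightarrow>
          fourier f y * exp (\<i> * complex_of_real (y \<bullet> x)) * complex_of_real (exp (- (0\<^sup>2 / 2)))"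
        by (intro tendsto_intros *) simp
      then show "(\<lambda>k. fourier f y * exp (\<i> * complex_of_real (y \<bullet> x)) * ?G k y) \<longlonglongrightarrow>
          fourier f y * exp (\<i> * complex_of_real (y \<bullet> x))"
        by simp
    qed
    show "AE y in lborel. norm (fourier f y * exp (\<i> * complex_of_real (y \<bullet> x)) * ?G k y) \<le> norm (fourier f y)" for k
      by (auto simp: norm_mult intro!: mult_left_le)
  qed (use Ff in auto)
  have L: "?L k = ?c * (\<integral>u. f (x - u) * ?H k u \<partial>lborel)" for k
  proof -
    let ?F = "\<lambda>y u. f (x - u) * (exp (\<i> * complex_of_real (u \<bullet> y)) * ?G k y)"
    have intx: "integrable lborel (\<lambda>u. f (x - u))"
      using integrable_lborel_affine[OF f, of "-1" x] by simp
    have intG: "integrable lborel (\<lambda>y. exp (\<i> * complex_of_real (u \<bullet> y)) * ?G k y)" for u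
      by (rule gaussian_fourier(1)) simp
    have "fourier f y * exp (\<i> * complex_of_real (y \<bullet> x)) * ?G k y = (\<integral>u. ?F y u \<partial>lborel)" for y
    proof -
      have Fy0: "fourier f y = (\<integral>u. exp (- \<i> * complex_of_real ((x + (-1) *\<^sub>R u) \<bullet> y)) * f (x + (-1) *\<^sub>R u) \<partial>lborel)"
        by (subst fourier_lborel, measurable, subst integral_lborel_affine[where c="-1" and t=x]) auto
      have regroup: "a * b * (c * d) = b * (e * d)" if "a * c = e" for a b c d e :: complex
        using that by (auto simp: ac_simps)
      have Fy: "fourier f y = (\<integral>u. exp (- \<i> * complex_of_real ((x - u) \<bullet> y)) * f (x - u) \<partial>lborel)"
        using Fy0 by simp
      have "fourier f y * exp (\<i> * complex_of_real (y \<bullet> x)) * ?G k y =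
          (\<integral>u. exp (- \<i> * complex_of_real ((x - u) \<bullet> y)) * f (x - u) * (exp (\<i> * complex_of_real (y \<bullet> x)) * ?G k y) \<partial>lborel)"
        by (simp only: Fy mult.assoc flip: integral_mult_left_zero)
      also have "\<dots> = (\<integral>u. ?F y u \<partial>lborel)"
      proof (rule Bochner_Integration.integral_cong[OF refl])
        fix u
        have "exp (- \<i> * complex_of_real ((x - u) \<bullet> y)) * exp (\<i> * complex_of_real (y \<bullet> x)) = exp (\<i> * complex_of_real (u \<bullet> y))"
          by (simp add: exp_add[symmetric] inner_diff_left inner_commute algebra_simps)
        then show "exp (- \<i> * complex_of_real ((x - u) \<bullet> y)) * f (x - u) * (exp (\<i> * complex_of_real (y \<bullet> x)) * ?G k y) = ?F y u"
          by (rule regroup)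
      qed
      finally show ?thesis .
    qed
    then have "?L k = (\<integral>y. (\<integral>u. ?F y u \<partial>lborel) \<partial>lborel)"
      by simp
    also have "\<dots> = (\<integral>u. (\<integral>y. ?F y u \<partial>lborel) \<partial>lborel)"
    proof (rule lborel_pair.Fubini_integral)
      show "integrable (lborel \<Otimes>\<^sub>M lborel) (\<lambda>(u, y). ?F y u)"
      proof (rule lborel_pair.Fubini_integrable)
        have "(\<integral>y. norm (?F y u) \<partial>lborel) = norm (f (x - u)) * (\<integral>y. norm (?G k y) \<partial>lborel)" for u
          by (simp add: norm_mult)
        then show "integrable lborel (\<lambda>u. \<integral>y. norm (case (u, y) of (u, y) \<Rightarrow> ?F y u) \<partial>lborel)"
          using intx by simp
        show "AE u in lborel. integrable lborel (\<lambda>y. case (u, y) of (u, y) \<Rightarrow> ?F y u)"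
          using intG by (auto intro!: integrable_mult_right)
      qed measurable
    qed
    also have "\<dots> = (\<integral>u. ?c * (f (x - u) * ?H k u) \<partial>lborel)"
    proof (rule Bochner_Integration.integral_cong[OF refl])
      fix u :: "real ^ 'n"
      have "(\<integral>y. ?F y u \<partial>lborel) = f (x - u) * complex_of_real ((real (Suc k) * sqrt (2 * pi)) ^ DIM(real ^ 'n) * exp (- ((real (Suc k) * norm u)\<^sup>2 / 2)))"
        by (subst integral_mult_right_zero, subst gaussian_fourier(2)) auto
      then show "(\<integral>y. ?F y u \<partial>lborel) = ?c * (f (x - u) * ?H k u)"
        by (simp add: power_mult_distrib ac_simps del: of_nat_Suc)
    qed
    also have "\<dots> = ?c * (\<integral>u. f (x - u) * ?H k u \<partial>lborel)"
      by (rule integral_mult_right_zero)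
    finally show ?thesis .
  qed
  let ?f1 = "\<lambda>u. indicator (ball 0 1) u * f (x - u)" and ?f2 = "\<lambda>u. indicator (- ball 0 1) u * f (x - u)"
  have intx: "integrable lborel (\<lambda>u. f (x - u))"
    using integrable_lborel_affine[OF f, of "-1" x] by simp
  have intf: "integrable lborel ?f1" "integrable lborel ?f2"
    by (rule Bochner_Integration.integrable_bound[OF intx], measurable, auto split: split_indicator)+
  have Hb: "norm (?H k u) \<le> real (Suc k) ^ DIM(real ^ 'n)" for k u
  proof -
    have "norm (?H k u) = real (Suc k) ^ DIM(real ^ 'n) * exp (- ((real (Suc k) * norm u)\<^sup>2 / 2))"
      unfolding norm_of_real by (simp del: of_nat_Suc)
    also have "\<dots> \<le> real (Suc k) ^ DIM(real ^ 'n) * 1"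
      by (intro mult_left_mono) auto
    finally show ?thesis by simp
  qed
  have intH: "integrable lborel (\<lambda>u. g u * ?H k u)" if g: "integrable lborel g" for k and g :: "real ^ 'n \<Rightarrow> complex"
  proof (rule Bochner_Integration.integrable_bound)
    show "integrable lborel (\<lambda>u. real (Suc k) ^ DIM(real ^ 'n) * norm (g u))"
      using g by auto
    show "(\<lambda>u. g u * ?H k u) \<in> borel_measurable lborel"
      using g by measurable
    show "AE u in lborel. norm (g u * ?H k u) \<le> norm (real (Suc k) ^ DIM(real ^ 'n) * norm (g u))"
    proof (rule AE_I2)
      fix u
      have "norm (g u) * norm (?H k u) \<le> norm (g u) * real (Suc k) ^ DIM(real ^ 'n)"
        using Hb by (intro mult_left_mono) auto
      then show "norm (g u * ?H k u) \<le> norm (real (Suc k) ^ DIM(real ^ 'n) * norm (g u))"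
        by (simp add: norm_mult mult.commute del: of_nat_Suc)
    qed
  qed
  have split: "(\<integral>u. f (x - u) * ?H k u \<partial>lborel) = (\<integral>u. ?f1 u * ?H k u \<partial>lborel) + (\<integral>u. ?f2 u * ?H k u \<partial>lborel)" for k
  proof -
    have "f (x - u) * ?H k u = ?f1 u * ?H k u + ?f2 u * ?H k u" for u
      by (auto split: split_indicator)
    then have "(\<integral>u. f (x - u) * ?H k u \<partial>lborel) = (\<integral>u. ?f1 u * ?H k u + ?f2 u * ?H k u \<partial>lborel)"
      by (intro Bochner_Integration.integral_cong refl)
    also have "\<dots> = (\<integral>u. ?f1 u * ?H k u \<partial>lborel) + (\<integral>u. ?f2 u * ?H k u \<partial>lborel)"
      by (intro Bochner_Integration.integral_add intH intf)
    finally show ?thesis .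
  qed
  have lim1: "(\<lambda>k. \<integral>u. ?f1 u * ?H k u \<partial>lborel) \<longlonglongrightarrow> ?f1 0 * complex_of_real (sqrt (2 * pi) ^ DIM(real ^ 'n))"
  proof -
    have "compact (f ` cball x 1)"
      by (intro compact_continuous_image compact_cball continuous_on_subset[OF cont]) auto
    then obtain C where C: "\<And>y. y \<in> cball x 1 \<Longrightarrow> norm (f y) \<le> C"
      by (meson bounded_iff compact_imp_bounded imageI)
    have "0 \<le> C"
      using C[of x] norm_ge_zero[of "f x"] by (simp del: norm_ge_zero)
    show ?thesis
    proof (rule gaussian_approximate_identity)
      show "?f1 \<in> borel_measurable borel"
        using borel_measurable_integrable[OF intf(1)] by simp
      show "norm (?f1 u) \<le> C" for u
        using C[of "x - u"] \<open>0 \<le> C\<close> by (auto simp: dist_norm split: split_indicator)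
      have "continuous_on UNIV (\<lambda>u. f (x - u))"
        by (intro continuous_on_compose2[OF cont] continuous_intros) auto
      then have "isCont (\<lambda>u. f (x - u)) 0"
        by (simp add: continuous_on_eq_continuous_at)
      moreover have "\<forall>\<^sub>F u in nhds 0. f (x - u) = ?f1 u"
        by (rule eventually_nhds_in_open[of "ball 0 1", THEN eventually_mono]) auto
      ultimately show "isCont ?f1 0"
        by (subst (asm) isCont_cong)
    qed
  qed
  have lim2: "(\<lambda>k. \<integral>u. ?f2 u * ?H k u \<partial>lborel) \<longlonglongrightarrow> 0"
    by (rule gaussian_away_from_origin[OF intf(2)]) auto
  have f1: "?f1 0 = f x" and dim: "DIM(real ^ 'n) = ?n"
    by simp_all
  have "(\<lambda>k. ?c * ((\<integral>u. ?f1 u * ?H k u \<partial>lborel) + (\<integral>u. ?f2 u * ?H k u \<partial>lborel)))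
      \<longlonglongrightarrow> ?c * (?f1 0 * complex_of_real (sqrt (2 * pi) ^ DIM(real ^ 'n)) + 0)"
    by (intro tendsto_mult tendsto_const tendsto_add lim1 lim2)
  also have "?c * (?f1 0 * complex_of_real (sqrt (2 * pi) ^ DIM(real ^ 'n)) + 0)
      = complex_of_real (sqrt (2 * pi) ^ ?n * sqrt (2 * pi) ^ ?n) * f x"
    by (simp only: f1 dim add_0_right) (simp only: of_real_mult ac_simps)
  also have "sqrt (2 * pi) ^ ?n * sqrt (2 * pi) ^ ?n = (2 * pi) ^ ?n"
    by (simp only: power_mult_distrib[symmetric] real_sqrt_mult_self) simp
  finally show "?L \<longlonglongrightarrow> complex_of_real ((2 * pi) ^ ?n) * f x"
    by (simp only: L split)
qed

section \<open>Plancherel\<close>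

lemma borel_measurable_cnj [measurable]:
  "f \<in> borel_measurable M \<Longrightarrow> (\<lambda>x. cnj (f x)) \<in> borel_measurable M"
  by (rule borel_measurable_continuous_on[OF continuous_on_cnj[OF continuous_on_id]])

lemma fourier_cnj_lborel:
  fixes f :: "real ^ 'n \<Rightarrow> complex"
  assumes [measurable]: "f \<in> borel_measurable borel"
  shows "cnj (fourier f y) = (\<integral>x. exp (\<i> * complex_of_real (x \<bullet> y)) * cnj (f x) \<partial>lborel)"
proof -
  have "cnj (fourier f y) = (\<integral>x. cnj (exp (- \<i> * complex_of_real (x \<bullet> y)) * f x) \<partial>lborel)"
    unfolding fourier_lborel[OF assms] by (rule Bochner_Integration.integral_cnj[symmetric])
  then show ?thesis
    by (simp add: exp_cnj)
qed

lemma norm_fourier_le: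
  fixes f :: "real ^ 'n \<Rightarrow> complex"
  assumes f: "integrable lborel f"
  shows "norm (fourier f y) \<le> (\<integral>x. norm (f x) \<partial>lborel)"
proof -
  have [measurable]: "f \<in> borel_measurable borel" using f by auto
  have "norm (fourier f y) \<le> (\<integral>x. norm (exp (- \<i> * complex_of_real (x \<bullet> y)) * f x) \<partial>lborel)"
    unfolding fourier_lborel[OF \<open>f \<in> borel_measurable borel\<close>] by (rule integral_norm_bound)
  also have "\<dots> = (\<integral>x. norm (f x) \<partial>lborel)"
    by (simp add: norm_mult)
  finally show ?thesis .
qed

lemma bounded_if_fourier_integrable:
  fixes f :: "real ^ 'n \<Rightarrow> complex"
  assumes cont: "continuous_on UNIV f" and f: "integrable lborel f" and Ff: "integrable lborel (fourier f)"
  shows "norm (f x) \<le> (\<integral>y. norm (fourier f y) \<partial>lborel) / (2 * pi) ^ CARD('n)"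
proof -
  have "(2 * pi) ^ CARD('n) * norm (f x) = norm (\<integral>y. fourier f y * exp (\<i> * complex_of_real (y \<bullet> x)) \<partial>lborel)"
    unfolding fourier_inversion[OF assms] norm_mult norm_of_real by simp
  also have "\<dots> \<le> (\<integral>y. norm (fourier f y * exp (\<i> * complex_of_real (y \<bullet> x))) \<partial>lborel)"
    by (rule integral_norm_bound)
  also have "\<dots> = (\<integral>y. norm (fourier f y) \<partial>lborel)"
    by (simp add: norm_mult)
  finally show ?thesis
    by (simp add: field_simps)
qed

lemma integrable_norm_square_if_bounded:
  fixes f :: "'a \<Rightarrow> complex"
  assumes f: "integrable M f" and C: "\<And>x. norm (f x) \<le> C"
  shows "integrable M (\<lambda>x. (norm (f x))\<^sup>2)"
proof (rule Bochner_Integration.integrable_bound)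
  show "integrable M (\<lambda>x. C * norm (f x))"
    using f by auto
  show "(\<lambda>x. (norm (f x))\<^sup>2) \<in> borel_measurable M"
    using f by measurable
  show "AE x in M. norm ((norm (f x))\<^sup>2) \<le> norm (C * norm (f x))"
  proof (rule AE_I2)
    fix x
    have "norm (f x) * norm (f x) \<le> C * norm (f x)"
      using C by (intro mult_right_mono) auto
    then show "norm ((norm (f x))\<^sup>2) \<le> norm (C * norm (f x))"
      by (simp add: power2_eq_square)
  qed
qed

text \<open>When \<open>f\<close> can be recovered from its integrable transform, inserting the inversion formula for one of
  the two factors in \<open>f * cnj f\<close> and exchanging the integrals gives the identity without passing to
  a limit in \<open>L\<^sub>2\<close>.\<close>

theorem plancherel:
  fixes f :: "real ^ 'n \<Rightarrow> complex"
  assumes cont: "continuous_on UNIV f" and f: "integrable lborel f" and Ff: "integrable lborel (fourier f)"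
  shows "(\<integral>y. (norm (fourier f y))\<^sup>2 \<partial>lborel) = (2 * pi) ^ CARD('n) * (\<integral>x. (norm (f x))\<^sup>2 \<partial>lborel)"
proof -
  note [measurable] = borel_measurable_continuous_onI[OF cont] borel_measurable_fourier[OF f]
  let ?F = "\<lambda>x y. fourier f y * exp (\<i> * complex_of_real (y \<bullet> x)) * cnj (f x)"
  have "complex_of_real ((2 * pi) ^ CARD('n) * (\<integral>x. (norm (f x))\<^sup>2 \<partial>lborel))
      = (\<integral>x. complex_of_real ((2 * pi) ^ CARD('n)) * f x * cnj (f x) \<partial>lborel)"
    by (simp add: mult.assoc complex_norm_square[symmetric] flip: of_real_power)
  also have "\<dots> = (\<integral>x. (\<integral>y. ?F x y \<partial>lborel) \<partial>lborel)"
    unfolding fourier_inversion[OF assms, symmetric] by simp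
  also have "\<dots> = (\<integral>y. (\<integral>x. ?F x y \<partial>lborel) \<partial>lborel)"
  proof (rule lborel_pair.Fubini_integral)
    show "integrable (lborel \<Otimes>\<^sub>M lborel) (\<lambda>(y, x). ?F x y)"
    proof (rule lborel_pair.Fubini_integrable)
      have "(\<integral>x. norm (case (y, x) of (y, x) \<Rightarrow> ?F x y) \<partial>lborel) = norm (fourier f y) * (\<integral>x. norm (f x) \<partial>lborel)" for y
        by (simp add: norm_mult)
      then show "integrable lborel (\<lambda>y. \<integral>x. norm (case (y, x) of (y, x) \<Rightarrow> ?F x y) \<partial>lborel)"
        using Ff by simp
      show "AE y in lborel. integrable lborel (\<lambda>x. case (y, x) of (y, x) \<Rightarrow> ?F x y)"
      proof (rule AE_I2)
        fix y
        have "integrable lborel (\<lambda>x. norm (fourier f y) * norm (f x))"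
          using f by auto
        then show "integrable lborel (\<lambda>x. case (y, x) of (y, x) \<Rightarrow> ?F x y)"
          unfolding case_prod_conv
          by (rule Bochner_Integration.integrable_bound) (measurable, auto simp: norm_mult)
      qed
    qed measurable
  qed
  also have "\<dots> = (\<integral>y. fourier f y * cnj (fourier f y) \<partial>lborel)"
  proof (rule Bochner_Integration.integral_cong[OF refl])
    fix y
    show "(\<integral>x. ?F x y \<partial>lborel) = fourier f y * cnj (fourier f y)"
      by (subst fourier_cnj_lborel) (simp_all add: inner_commute mult.assoc)
  qed
  also have "\<dots> = complex_of_real (\<integral>y. (norm (fourier f y))\<^sup>2 \<partial>lborel)"
    by (simp add: complex_norm_square[symmetric] flip: of_real_power)
  finally show ?thesis
    by (simp only: of_real_eq_iff)
qed

section \<open>The dual lattice and its period cell\<close>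

abbreviation dual_pt :: "real ^ 'n ^ 'n \<Rightarrow> int ^ 'n \<Rightarrow> real ^ 'n" where
  "dual_pt A m \<equiv> dual_map A (int_vec m)"

text \<open>For invertible \<open>A\<close> the inverse of \<open>dual_map A\<close>, written without \<open>matrix_inv\<close>.\<close>

definition dual_coord :: "real ^ 'n ^ 'n \<Rightarrow> real ^ 'n \<Rightarrow> real ^ 'n" where
  "dual_coord A z = (1 / (2 * pi)) *\<^sub>R (transpose A *v z)"

text \<open>Half open, so that the translates by the dual lattice partition the space and every point lies in
  exactly one of them.\<close>

definition cell :: "real ^ 'n ^ 'n \<Rightarrow> (real ^ 'n) set" where
  "cell A = {z. \<forall>k. 0 \<le> dual_coord A z $ k \<and> dual_coord A z $ k < 1}"

definition cell_volume :: "real ^ 'n ^ 'n \<Rightarrow> real" where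
  "cell_volume A = (2 * pi) ^ CARD('n) / \<bar>det A\<bar>"

definition tile_index :: "real ^ 'n ^ 'n \<Rightarrow> real ^ 'n \<Rightarrow> int ^ 'n" where
  "tile_index A z = (\<chi> k. \<lfloor>dual_coord A z $ k\<rfloor>)"

definition lattice_char :: "real ^ 'n ^ 'n \<Rightarrow> int ^ 'n \<Rightarrow> real ^ 'n \<Rightarrow> complex" where
  "lattice_char A s z = exp (\<i> * complex_of_real (lattice_pt A s \<bullet> z))"

lemma int_vec_simps [simp]:
  "int_vec (s + t) = int_vec s + int_vec t" "int_vec (s - t) = int_vec s - int_vec t"
  "int_vec (- s) = - int_vec s" "int_vec 0 = 0" "int_vec s $ k = real_of_int (s $ k)"
  by (simp_all add: int_vec_def vec_eq_iff)

lemma dual_map_simps: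
  "dual_map A (v + w) = dual_map A v + dual_map A w" "dual_map A (v - w) = dual_map A v - dual_map A w"
  "dual_map A (- v) = - dual_map A v" "dual_map A 0 = 0"
  by (simp_all add: dual_map_def matrix_vector_right_distrib matrix_vector_mult_diff_distrib scaleR_right_distrib
      scaleR_right_diff_distrib vec.neg)

lemma lattice_pt_simps:
  "lattice_pt A (s + t) = lattice_pt A s + lattice_pt A t" "lattice_pt A (s - t) = lattice_pt A s - lattice_pt A t"
  "lattice_pt A (- s) = - lattice_pt A s" "lattice_pt A 0 = 0"
  by (simp_all add: lattice_pt_def matrix_vector_right_distrib matrix_vector_mult_diff_distrib vec.neg)

lemma dual_coord_diff: "dual_coord A (z - w) = dual_coord A z - dual_coord A w"
  by (simp add: dual_coord_def matrix_vector_mult_diff_distrib scaleR_right_diff_distrib)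

lemma continuous_on_dual_coord: "continuous_on S (dual_coord A)"
  unfolding dual_coord_def by (intro continuous_intros)

lemma cell_borel [measurable]: "cell A \<in> sets borel"
proof -
  have [measurable]: "(\<lambda>z. dual_coord A z $ k) \<in> borel_measurable borel" for k
    by (intro borel_measurable_continuous_onI continuous_intros continuous_on_dual_coord)
  show ?thesis
    unfolding cell_def by measurable
qed

lemma lattice_char_simps:
  "lattice_char A (s + t) z = lattice_char A s z * lattice_char A t z"
  "lattice_char A (s - t) z = lattice_char A s z * cnj (lattice_char A t z)"
  "lattice_char A (- s) z = cnj (lattice_char A s z)"
  "lattice_char A 0 z = 1" "norm (lattice_char A s z) = 1" "lattice_char A s 0 = 1"
  "lattice_char A s (z + w) = lattice_char A s z * lattice_char A s w"
  "lattice_char A s (- z) = cnj (lattice_char A s z)"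
  by (simp_all add: lattice_char_def lattice_pt_simps exp_cnj exp_add[symmetric] algebra_simps)

lemma exp_eq_cnj_lattice_char:
  "exp (- \<i> * complex_of_real (lattice_pt A s \<bullet> z)) = cnj (lattice_char A s z)"
  by (simp add: lattice_char_def exp_cnj)

lemma lattice_char_borel [measurable]: "lattice_char A s \<in> borel_measurable borel"
  unfolding lattice_char_def[abs_def] by measurable

context
  fixes A :: "real ^ 'n ^ 'n"
  assumes A: "invertible A"
begin

lemma dual_coord_dual_map: "dual_coord A (dual_map A v) = v"
  and dual_map_dual_coord: "dual_map A (dual_coord A z) = z"
  and inner_dual_map: "(A *v w) \<bullet> dual_map A v = 2 * pi * (w \<bullet> v)"
proof -
  have inv: "A ** matrix_inv A = mat 1 \<and> matrix_inv A ** A = mat 1"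
    using A unfolding invertible_def matrix_inv_def by (rule someI_ex)
  then have 1: "transpose A ** transpose (matrix_inv A) = mat 1"
      and 2: "transpose (matrix_inv A) ** transpose A = mat 1"
    by (simp_all flip: matrix_transpose_mul)
  show "dual_coord A (dual_map A v) = v"
    by (simp only: dual_coord_def dual_map_def matrix_vector_mult_scaleR matrix_vector_mul_assoc 1
        matrix_vector_mul_lid scaleR_scaleR) simp
  show "dual_map A (dual_coord A z) = z"
    by (simp only: dual_coord_def dual_map_def matrix_vector_mult_scaleR matrix_vector_mul_assoc 2
        matrix_vector_mul_lid scaleR_scaleR) simp
  have "(A *v w) \<bullet> dual_map A v = 2 * pi * ((A *v w) \<bullet> (transpose (matrix_inv A) *v v))"
    by (simp add: dual_map_def)
  also have "(A *v w) \<bullet> (transpose (matrix_inv A) *v v) = ((A *v w) v* transpose (matrix_inv A)) \<bullet> v"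
    by (simp only: dot_lmul_matrix)
  also have "(A *v w) v* transpose (matrix_inv A) = transpose (transpose (matrix_inv A)) *v (A *v w)"
    by (simp only: transpose_matrix_vector)
  also have "\<dots> = w"
    using inv by (simp only: transpose_transpose matrix_vector_mul_assoc matrix_vector_mul_lid)
  finally show "(A *v w) \<bullet> dual_map A v = 2 * pi * (w \<bullet> v)" .
qed

lemma lattice_char_periodic [simp]: "lattice_char A s (dual_pt A m) = 1"
proof -
  have "lattice_pt A s \<bullet> dual_pt A m = 2 * pi * of_int (\<Sum>k\<in>UNIV. s $ k * m $ k)"
    unfolding lattice_pt_def inner_dual_map by (simp add: inner_vec_def)
  then have "lattice_char A s (dual_pt A m) = exp (complex_of_real (2 * pi * of_int (\<Sum>k\<in>UNIV. s $ k * m $ k)) * \<i>)"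
    unfolding lattice_char_def by (simp only: mult.commute)
  then show ?thesis
    using exp_integer_2pi[of "of_int (\<Sum>k\<in>UNIV. s $ k * m $ k)"] by (simp only: Ints_of_int of_real_mult of_real_of_int_eq of_real_numeral) (simp add: ac_simps)
qed

lemma cell_translate_iff: "z - dual_pt A m \<in> cell A \<longleftrightarrow> m = tile_index A z"
proof -
  have "z - dual_pt A m \<in> cell A \<longleftrightarrow> (\<forall>k. m $ k = \<lfloor>dual_coord A z $ k\<rfloor>)"
    unfolding cell_def by (simp add: dual_coord_diff dual_coord_dual_map eq_commute[of "_ $ _" "floor _"] floor_eq_iff)
      (metis add.commute diff_less_eq)
  then show ?thesis
    by (simp add: tile_index_def vec_eq_iff)
qed

lemma cell_translate_iff': "z + dual_pt A m \<in> cell A \<longleftrightarrow> m = - tile_index A z"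
  using cell_translate_iff[of z "- m"] by (simp add: dual_map_simps) (metis minus_equation_iff)

lemma indicator_tile_has_sum:
  fixes c :: "int ^ 'n \<Rightarrow> complex"
  shows "((\<lambda>m. indicator (cell A) (z - dual_pt A m) * c m) has_sum c (tile_index A z)) UNIV"
    and "((\<lambda>m. indicator (cell A) (z + dual_pt A m) * c m) has_sum c (- tile_index A z)) UNIV"
  by (rule has_sum_finite_neutralI[of "{tile_index A z}"]; simp add: indicator_def cell_translate_iff)
     (rule has_sum_finite_neutralI[of "{- tile_index A z}"];
       simp add: indicator_def cell_translate_iff' del: int_vec_simps)

text \<open>Disjoint translates of the cell cannot carry more than the whole integral. This bound gives the
  summability in the unfolding below, and by itself the lower bound for the norm of a spline.\<close>

lemma sum_tiles_le:
  fixes h :: "real ^ 'n \<Rightarrow> real"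
  assumes h: "integrable lborel h" and nonneg: "\<And>z. 0 \<le> h z" and F: "finite F"
  shows "(\<Sum>m\<in>F. \<integral>z. indicator (cell A) (z - dual_pt A m) * h z \<partial>lborel) \<le> (\<integral>z. h z \<partial>lborel)"
proof -
  have [measurable]: "h \<in> borel_measurable borel" using h by auto
  have int: "integrable lborel (\<lambda>z. indicator (cell A) (z - dual_pt A m) * h z)" for m
    by (rule Bochner_Integration.integrable_bound[OF h]) (measurable, auto split: split_indicator)
  have "(\<Sum>m\<in>F. \<integral>z. indicator (cell A) (z - dual_pt A m) * h z \<partial>lborel)
      = (\<integral>z. (\<Sum>m\<in>F. indicator (cell A) (z - dual_pt A m) * h z) \<partial>lborel)"
    using int by (subst Bochner_Integration.integral_sum) auto
  also have "\<dots> \<le> (\<integral>z. h z \<partial>lborel)"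
  proof (rule integral_mono)
    fix z
    have "(\<Sum>m\<in>F. indicator (cell A) (z - dual_pt A m) * h z) = (\<Sum>m\<in>F. if m = tile_index A z then h z else 0)"
      by (intro sum.cong refl) (simp add: indicator_def cell_translate_iff)
    also have "\<dots> \<le> h z"
      using F nonneg by (simp add: sum.delta)
    finally show "(\<Sum>m\<in>F. indicator (cell A) (z - dual_pt A m) * h z) \<le> h z" .
  qed (use int h in auto)
  finally show ?thesis .
qed

lemma integral_tile_shift:
  fixes h :: "real ^ 'n \<Rightarrow> 'b::{banach, second_countable_topology, real_normed_algebra_1}"
  assumes [measurable]: "h \<in> borel_measurable borel"
  shows "(\<integral>z. indicator (cell A) (z - w) * h z \<partial>lborel) = (\<integral>z. indicator (cell A) z * h (z + w) \<partial>lborel)"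
  by (subst integral_lborel_affine[where c=1 and t=w]) (simp_all add: add.commute)

text \<open>Cut the space into translates of the cell, move every piece back to the cell, and add up there.\<close>

lemma unfold_over_dual_lattice:
  fixes h H :: "real ^ 'n \<Rightarrow> complex"
  assumes h: "integrable lborel h" and H: "\<And>z. ((\<lambda>m. h (z + dual_pt A m)) has_sum H z) UNIV"
  shows "integrable lborel (\<lambda>z. indicator (cell A) z * H z)"
    and "(\<integral>z. indicator (cell A) z * H z \<partial>lborel) = (\<integral>z. h z \<partial>lborel)"
proof -
  have [measurable]: "h \<in> borel_measurable borel" using h by auto
  let ?f = "\<lambda>m z. indicator (cell A) (z - dual_pt A m) * h z" and ?g = "\<lambda>m z. indicator (cell A) z * h (z + dual_pt A m)"
  have intf: "integrable lborel (?f m)" for m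
    by (rule Bochner_Integration.integrable_bound[OF h]) (measurable, auto split: split_indicator)
  have intg: "integrable lborel (?g m)" for m
    using integrable_lborel_affine[OF intf[of m], of 1 "dual_pt A m"] by (simp add: add.commute)
  have shift: "(\<integral>z. ?f m z \<partial>lborel) = (\<integral>z. ?g m z \<partial>lborel)"
      and shift_norm: "(\<integral>z. norm (?f m z) \<partial>lborel) = (\<integral>z. norm (?g m z) \<partial>lborel)" for m
  proof -
    have "norm (?f m z) = indicator (cell A) (z - dual_pt A m) * norm (h z)"
        "norm (?g m z) = indicator (cell A) z * norm (h (z + dual_pt A m))" for z
      by (auto simp: norm_mult split: split_indicator)
    then show "(\<integral>z. norm (?f m z) \<partial>lborel) = (\<integral>z. norm (?g m z) \<partial>lborel)"
      using integral_tile_shift[of "\<lambda>z. norm (h z)" "dual_pt A m"] by simp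
  qed (rule integral_tile_shift, simp)
  have sum: "(\<lambda>m. \<integral>z. norm (?f m z) \<partial>lborel) summable_on UNIV"
  proof (rule nonneg_bdd_above_summable_on)
    show "bdd_above (sum (\<lambda>m. \<integral>z. norm (?f m z) \<partial>lborel) ` {F. F \<subseteq> UNIV \<and> finite F})"
    proof (rule bdd_aboveI2)
      fix F :: "(int ^ 'n) set" assume "F \<in> {F. F \<subseteq> UNIV \<and> finite F}"
      then have "(\<Sum>m\<in>F. \<integral>z. indicator (cell A) (z - dual_pt A m) * norm (h z) \<partial>lborel) \<le> (\<integral>z. norm (h z) \<partial>lborel)"
        using h by (intro sum_tiles_le) auto
      also have "(\<lambda>m. \<integral>z. indicator (cell A) (z - dual_pt A m) * norm (h z) \<partial>lborel) = (\<lambda>m. \<integral>z. norm (?f m z) \<partial>lborel)"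
        by (intro ext Bochner_Integration.integral_cong refl) (auto simp: norm_mult split: split_indicator)
      finally show "(\<Sum>m\<in>F. \<integral>z. norm (?f m z) \<partial>lborel) \<le> (\<integral>z. norm (h z) \<partial>lborel)" .
    qed
  qed simp
  have 1: "((\<lambda>m. \<integral>z. ?f m z \<partial>lborel) has_sum (\<integral>z. h z \<partial>lborel)) UNIV"
    by (rule integral_has_sum(2)[OF intf sum indicator_tile_has_sum(1)])
  have g_sum: "((\<lambda>m. ?g m z) has_sum indicator (cell A) z * H z) UNIV" for z
    by (intro has_sum_cmult_right H)
  note g = integral_has_sum[OF intg sum[unfolded shift_norm] g_sum]
  show "integrable lborel (\<lambda>z. indicator (cell A) z * H z)"
    by (rule g(1))
  show "(\<integral>z. indicator (cell A) z * H z \<partial>lborel) = (\<integral>z. h z \<partial>lborel)"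
    using 1 g(2) unfolding shift by (rule has_sum_unique[symmetric])
qed

text \<open>The map \<open>dual_coord A\<close> takes the cell to the half open unit cube, and its determinant is
  \<open>det A / (2 * pi) ^ n\<close>.\<close>

lemma emeasure_cell: "emeasure lborel (cell A) = ennreal ((2 * pi) ^ CARD('n) / \<bar>det A\<bar>)"
proof -
  let ?Q = "{x :: real ^ 'n. \<forall>k. 0 \<le> x $ k \<and> x $ k < 1}"
  let ?B = "(\<chi> i. (1 / (2 * pi)) *s (transpose A $ i)) :: real ^ 'n ^ 'n"
  have B: "?B *v z = dual_coord A z" for z
    by (simp add: dual_coord_def vec_eq_iff matrix_vector_mult_def sum_distrib_left mult.assoc)
  have detB: "det ?B = det A / (2 * pi) ^ CARD('n)"
    by (subst det_rows_mul) (simp only: vec_lambda_eta det_transpose prod_constant power_one_over, simp only: times_divide_eq_left mult_1)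
  have nz: "det A \<noteq> 0"
    using A by (simp add: invertible_det_nz)
  have [measurable]: "?Q \<in> sets borel"
    by measurable
  have one: "(\<Prod>b\<in>Basis. (1 :: real ^ 'n) \<bullet> b) = 1"
    by (rule prod.neutral) (auto simp: Basis_vec_def inner_axis)
  have Q: "emeasure lborel ?Q = 1"
  proof (rule antisym)
    have "?Q \<subseteq> cbox 0 1"
      by (auto simp: mem_box_cart less_imp_le)
    then have "emeasure lborel ?Q \<le> emeasure lborel (cbox 0 (1 :: real ^ 'n))"
      by (intro emeasure_mono) auto
    also have "\<dots> = 1"
      by (subst emeasure_lborel_cbox_eq) (auto simp: one, auto simp: Basis_vec_def inner_axis)
    finally show "emeasure lborel ?Q \<le> 1" .
    have "box 0 1 \<subseteq> ?Q"
      by (auto simp: mem_box_cart less_imp_le)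
    then have "emeasure lborel (box 0 (1 :: real ^ 'n)) \<le> emeasure lborel ?Q"
      by (intro emeasure_mono) auto
    moreover have "emeasure lborel (box 0 (1 :: real ^ 'n)) = 1"
      by (subst emeasure_lborel_box_eq) (auto simp: one, auto simp: Basis_vec_def inner_axis)
    ultimately show "1 \<le> emeasure lborel ?Q" by simp
  qed
  have "emeasure lborel (cell A) = (\<integral>\<^sup>+z. indicator ?Q (?B *v z) \<partial>lborel)"
    by (subst nn_integral_indicator[symmetric], simp)
       (auto simp: B cell_def intro!: nn_integral_cong split: split_indicator)
  moreover have "(\<integral>\<^sup>+z. indicator ?Q (?B *v z) \<partial>lborel) * ennreal \<bar>det ?B\<bar> = (\<integral>\<^sup>+z. indicator ?Q z \<partial>lborel)"
    using nz by (intro nn_integral_matrix) (auto simp: detB)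
  ultimately have eq: "emeasure lborel (cell A) * ennreal (\<bar>det A\<bar> / (2 * pi) ^ CARD('n)) = 1"
    by (simp add: Q detB abs_divide)
  have "emeasure lborel (cell A) =
      emeasure lborel (cell A) * ennreal (\<bar>det A\<bar> / (2 * pi) ^ CARD('n)) * ennreal ((2 * pi) ^ CARD('n) / \<bar>det A\<bar>)"
    using nz by (simp add: mult.assoc ennreal_mult'[symmetric])
  then show ?thesis
    by (simp only: eq mult_1)
qed

lemma cell_volume_pos: "cell_volume A > 0"
  using A by (simp add: invertible_det_nz cell_volume_def)

lemma integrable_cell:
  fixes h :: "real ^ 'n \<Rightarrow> 'b::{banach, second_countable_topology, real_normed_div_algebra}"
  assumes [measurable]: "h \<in> borel_measurable borel" and "\<And>z. z \<in> cell A \<Longrightarrow> norm (h z) \<le> C"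
  shows "integrable lborel (\<lambda>z. indicator (cell A) z * h z)"
proof (rule Bochner_Integration.integrable_bound)
  show "integrable lborel (\<lambda>z. indicator (cell A) z * C)"
    by (intro integrable_mult_left integrable_real_indicator) (auto simp: emeasure_cell)
  show "AE z in lborel. norm (indicator (cell A) z * h z) \<le> norm (indicator (cell A) z * C)"
    using assms(2) by (auto split: split_indicator simp: norm_mult intro: order_trans[OF _ abs_ge_self])
qed measurable

lemma integral_cell_const: "(\<integral>z. indicator (cell A) z * c \<partial>lborel) = complex_of_real (cell_volume A) * c"
proof -
  have "(\<integral>z. indicator (cell A) z * c \<partial>lborel) = (\<integral>z. complex_of_real (indicator (cell A) z) * c \<partial>lborel)"
    by (intro Bochner_Integration.integral_cong refl) (auto split: split_indicator)
  also have "\<dots> = complex_of_real (measure lborel (cell A)) * c"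
    by simp
  also have "measure lborel (cell A) = cell_volume A"
    using cell_volume_pos by (simp add: measure_def emeasure_cell cell_volume_def)
  finally show ?thesis .
qed

text \<open>For \<open>s \<noteq> 0\<close> there is a vector \<open>v\<close> at which the character takes the value \<open>-1\<close>. Integrals of periodic
  functions do not change when the cell is moved by \<open>v\<close>, which is the unfolding applied to the
  function cut off to the moved cell. So the integral equals its own negative.\<close>

lemma integral_lattice_char:
  "(\<integral>z. indicator (cell A) z * lattice_char A s z \<partial>lborel) = (if s = 0 then complex_of_real (cell_volume A) else 0)"
proof (cases "s = 0")
  case True
  then show ?thesis
    using integral_cell_const[of 1] by (simp add: lattice_char_simps)
next
  case False
  then obtain k where k: "s $ k \<noteq> 0"
    by (auto simp: vec_eq_iff)
  define v where "v = dual_map A (axis k (1 / (2 * real_of_int (s $ k))))"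
  have "lattice_pt A s \<bullet> v = pi"
    using k unfolding v_def lattice_pt_def inner_dual_map by (simp add: inner_axis)
  then have v: "lattice_char A s v = - 1"
    by (simp add: lattice_char_def)
  let ?I = "\<integral>z. indicator (cell A) z * lattice_char A s z \<partial>lborel"
  let ?h = "\<lambda>z. indicator (cell A) (z - v) * lattice_char A s z"
  have "integrable lborel (\<lambda>z. indicator (cell A) z * lattice_char A s (z + v))"
    by (rule integrable_cell[where C=1]) (measurable, simp add: lattice_char_simps norm_mult)
  from integrable_lborel_affine[OF this, of 1 "- v"] have "integrable lborel ?h"
    by simp
  moreover have "((\<lambda>m. ?h (z + dual_pt A m)) has_sum lattice_char A s z) UNIV" for z
    using indicator_tile_has_sum(2)[of "z - v" "\<lambda>_. lattice_char A s z"]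
    by (simp add: lattice_char_simps algebra_simps)
  ultimately have "?I = (\<integral>z. ?h z \<partial>lborel)"
    by (rule unfold_over_dual_lattice(2))
  also have "\<dots> = (\<integral>z. indicator (cell A) z * lattice_char A s (z + v) \<partial>lborel)"
    by (rule integral_tile_shift) simp
  also have "\<dots> = - ?I"
    by (simp add: lattice_char_simps v)
  finally show ?thesis
    using False by simp
qed

text \<open>Integrate term by term against a character. In particular two unordered trigonometric series with
  equal sums have equal coefficients.\<close>

lemma fourier_coefficient:
  assumes sum: "\<And>z. ((\<lambda>s. \<beta> s * cnj (lattice_char A s z)) has_sum H z) UNIV"
  shows "(\<integral>z. indicator (cell A) z * (H z * lattice_char A r z) \<partial>lborel) = complex_of_real (cell_volume A) * \<beta> r"
proof -
  have "(\<lambda>s. norm (\<beta> s * cnj (lattice_char A s 0))) summable_on UNIV"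
    using sum[of 0] by (metis has_sum_imp_summable summable_on_iff_abs_summable_on_complex)
  then have abs: "(\<lambda>s. norm (\<beta> s)) summable_on UNIV"
    by (simp add: lattice_char_simps)
  let ?f = "\<lambda>s z. indicator (cell A) z * (\<beta> s * lattice_char A (r - s) z)"
  have norm_eq: "(\<integral>z. norm (?f s z) \<partial>lborel) = cell_volume A * norm (\<beta> s)" for s
  proof -
    have "complex_of_real (\<integral>z. norm (?f s z) \<partial>lborel) = (\<integral>z. complex_of_real (norm (?f s z)) \<partial>lborel)"
      by simp
    also have "\<dots> = (\<integral>z. indicator (cell A) z * complex_of_real (norm (\<beta> s)) \<partial>lborel)"
      by (intro Bochner_Integration.integral_cong refl) (auto simp: norm_mult lattice_char_simps split: split_indicator)
    also have "\<dots> = complex_of_real (cell_volume A * norm (\<beta> s))"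
      by (simp only: integral_cell_const of_real_mult)
    finally show ?thesis
      by (simp only: of_real_eq_iff)
  qed
  have "((\<lambda>s. \<integral>z. ?f s z \<partial>lborel) has_sum (\<integral>z. indicator (cell A) z * (H z * lattice_char A r z) \<partial>lborel)) UNIV"
  proof (rule integral_has_sum(2))
    show "integrable lborel (?f s)" for s
      by (rule integrable_cell[where C="norm (\<beta> s)"]) (measurable, simp add: norm_mult lattice_char_simps)
    show "(\<lambda>s. \<integral>z. norm (?f s z) \<partial>lborel) summable_on UNIV"
      unfolding norm_eq by (intro summable_on_cmult_right abs)
    show "((\<lambda>s. ?f s z) has_sum indicator (cell A) z * (H z * lattice_char A r z)) UNIV" for z
      using has_sum_cmult_right[OF has_sum_cmult_left[OF sum[of z], of "lattice_char A r z"], of "indicator (cell A) z"]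
      by (simp add: lattice_char_simps ac_simps)
  qed
  moreover have "((\<lambda>s. \<integral>z. ?f s z \<partial>lborel) has_sum complex_of_real (cell_volume A) * \<beta> r) UNIV"
  proof (rule has_sum_finite_neutralI[of "{r}"])
    have eq: "(\<integral>z. ?f s z \<partial>lborel) = \<beta> s * (\<integral>z. indicator (cell A) z * lattice_char A (r - s) z \<partial>lborel)" for s
      by (subst integral_mult_right_zero[symmetric]) (simp add: ac_simps)
    show "(\<integral>z. ?f s z \<partial>lborel) = 0" if "s \<in> UNIV - {r}" for s
      using that unfolding eq integral_lattice_char by auto
    show "complex_of_real (cell_volume A) * \<beta> r = (\<Sum>s\<in>{r}. \<integral>z. ?f s z \<partial>lborel)"
      by (simp only: eq integral_lattice_char) (simp add: ac_simps)
  qed auto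
  ultimately show ?thesis
    by (rule has_sum_unique)
qed

lemma trigonometric_polynomial_norm:
  assumes F: "finite F"
  shows "(\<integral>z. indicator (cell A) z * (norm (\<Sum>m\<in>F. c m * cnj (lattice_char A m z)))\<^sup>2 \<partial>lborel)
    = cell_volume A * (\<Sum>m\<in>F. (norm (c m))\<^sup>2)"
proof -
  let ?f = "\<lambda>m l z. indicator (cell A) z * (c m * cnj (c l) * lattice_char A (l - m) z)"
  have int: "integrable lborel (?f m l)" for m l
    by (rule integrable_cell[where C="norm (c m) * norm (c l)"]) (measurable, simp add: norm_mult lattice_char_simps)
  have "complex_of_real (\<integral>z. indicator (cell A) z * (norm (\<Sum>m\<in>F. c m * cnj (lattice_char A m z)))\<^sup>2 \<partial>lborel)
      = (\<integral>z. complex_of_real (indicator (cell A) z * (norm (\<Sum>m\<in>F. c m * cnj (lattice_char A m z)))\<^sup>2) \<partial>lborel)"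
    by (rule integral_complex_of_real[symmetric])
  also have "\<dots> = (\<integral>z. (\<Sum>m\<in>F. \<Sum>l\<in>F. ?f m l z) \<partial>lborel)"
  proof (intro Bochner_Integration.integral_cong refl)
    fix z
    show "complex_of_real (indicator (cell A) z * (norm (\<Sum>m\<in>F. c m * cnj (lattice_char A m z)))\<^sup>2) = (\<Sum>m\<in>F. \<Sum>l\<in>F. ?f m l z)"
      unfolding of_real_mult complex_norm_square of_real_power[symmetric] cnj_sum sum_product
      by (simp add: sum_distrib_left lattice_char_simps ac_simps indicator_def)
  qed
  also have "\<dots> = (\<Sum>m\<in>F. \<Sum>l\<in>F. \<integral>z. ?f m l z \<partial>lborel)"
    using int by (simp only: Bochner_Integration.integral_sum Bochner_Integration.integrable_sum)
  also have "\<dots> = (\<Sum>m\<in>F. \<Sum>l\<in>F. if l = m then c m * cnj (c m) * complex_of_real (cell_volume A) else 0)"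
  proof (intro sum.cong refl)
    fix m l
    have "(\<integral>z. ?f m l z \<partial>lborel) = c m * cnj (c l) * (\<integral>z. indicator (cell A) z * lattice_char A (l - m) z \<partial>lborel)"
      by (subst integral_mult_right_zero[symmetric]) (simp add: ac_simps)
    then show "(\<integral>z. ?f m l z \<partial>lborel) = (if l = m then c m * cnj (c m) * complex_of_real (cell_volume A) else 0)"
      by (simp add: integral_lattice_char)
  qed
  also have "\<dots> = complex_of_real (cell_volume A * (\<Sum>m\<in>F. (norm (c m))\<^sup>2))"
    using F by (simp add: sum_distrib_left complex_norm_square ac_simps flip: of_real_power)
  finally show ?thesis
    by (simp only: of_real_eq_iff)
qed

text \<open>Expand the nonnegative integral of \<open>\<bar>V * p - q\<bar>\<^sup>2\<close>, with \<open>V\<close> the volume of the cell and \<open>q\<close> the partial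
  Fourier sum of \<open>V * p\<close>.\<close>

lemma bessel_inequality:
  assumes [measurable]: "p \<in> borel_measurable borel" and C: "\<And>z. norm (p z) \<le> C" and F: "finite F"
  shows "(\<Sum>s\<in>F. (norm (\<integral>z. indicator (cell A) z * (p z * lattice_char A s z) \<partial>lborel))\<^sup>2)
    \<le> cell_volume A * (\<integral>z. indicator (cell A) z * (norm (p z))\<^sup>2 \<partial>lborel)"
proof -
  define \<beta> where "\<beta> s = (\<integral>z. indicator (cell A) z * (p z * lattice_char A s z) \<partial>lborel)" for s
  define q where "q z = (\<Sum>m\<in>F. \<beta> m * cnj (lattice_char A m z))" for z
  define S where "S = (\<Sum>s\<in>F. (norm (\<beta> s))\<^sup>2)"
  define D where "D = (\<Sum>m\<in>F. norm (\<beta> m))"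
  have [measurable]: "q \<in> borel_measurable borel"
    unfolding q_def by measurable
  have q_le: "norm (q z) \<le> D" for z
    unfolding q_def D_def by (rule sum_norm_le) (simp add: norm_mult lattice_char_simps)
  have q_int: "(\<integral>z. indicator (cell A) z * (norm (q z))\<^sup>2 \<partial>lborel) = cell_volume A * S"
    unfolding q_def S_def by (rule trigonometric_polynomial_norm[OF F])
  have cross: "(\<integral>z. indicator (cell A) z * (p z * cnj (q z)) \<partial>lborel) = complex_of_real S"
  proof -
    have "(\<integral>z. indicator (cell A) z * (p z * cnj (q z)) \<partial>lborel)
        = (\<integral>z. (\<Sum>m\<in>F. cnj (\<beta> m) * (indicator (cell A) z * (p z * lattice_char A m z))) \<partial>lborel)"
      by (intro Bochner_Integration.integral_cong refl) (simp add: q_def sum_distrib_left ac_simps)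
    also have "\<dots> = (\<Sum>m\<in>F. \<integral>z. cnj (\<beta> m) * (indicator (cell A) z * (p z * lattice_char A m z)) \<partial>lborel)"
      by (intro Bochner_Integration.integral_sum integrable_mult_right integrable_cell[where C=C])
         (measurable, simp add: norm_mult lattice_char_simps C)
    also have "\<dots> = (\<Sum>m\<in>F. cnj (\<beta> m) * \<beta> m)"
      by (simp add: \<beta>_def)
    also have "\<dots> = complex_of_real S"
      by (simp add: S_def complex_norm_square mult.commute flip: of_real_power)
    finally show ?thesis .
  qed
  have intp: "integrable lborel (\<lambda>z. indicator (cell A) z * (norm (p z))\<^sup>2)"
    by (rule integrable_cell[where C="C\<^sup>2"]) (measurable, simp add: C power_mono)
  have intq: "integrable lborel (\<lambda>z. indicator (cell A) z * (norm (q z))\<^sup>2)"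
    by (rule integrable_cell[where C="D\<^sup>2"]) (measurable, simp add: q_le power_mono)
  have intc: "integrable lborel (\<lambda>z. indicator (cell A) z * (p z * cnj (q z)))"
    by (rule integrable_cell[where C="C * D"])
       (measurable, auto simp: norm_mult intro!: mult_mono C q_le order_trans[OF norm_ge_zero C])
  have intr: "integrable lborel (\<lambda>z. Re (indicator (cell A) z * (p z * cnj (q z))))"
    by (rule integrable_Re[OF intc])
  have "0 \<le> (\<integral>z. indicator (cell A) z * (norm (cell_volume A * p z - q z))\<^sup>2 \<partial>lborel)"
    by (rule integral_nonneg_AE) auto
  also have "\<dots> = (\<integral>z. (cell_volume A)\<^sup>2 * (indicator (cell A) z * (norm (p z))\<^sup>2)
      - 2 * cell_volume A * Re (indicator (cell A) z * (p z * cnj (q z))) + indicator (cell A) z * (norm (q z))\<^sup>2 \<partial>lborel)"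
  proof (intro Bochner_Integration.integral_cong refl)
    fix z
    have "(norm (cell_volume A * p z - q z))\<^sup>2 = (cell_volume A)\<^sup>2 * (norm (p z))\<^sup>2 - 2 * cell_volume A * Re (p z * cnj (q z)) + (norm (q z))\<^sup>2"
      by (simp only: cmod_power2) (simp add: power2_eq_square algebra_simps)
    then show "indicator (cell A) z * (norm (cell_volume A * p z - q z))\<^sup>2 = (cell_volume A)\<^sup>2 * (indicator (cell A) z * (norm (p z))\<^sup>2)
      - 2 * cell_volume A * Re (indicator (cell A) z * (p z * cnj (q z))) + indicator (cell A) z * (norm (q z))\<^sup>2"
      by (auto split: split_indicator)
  qed
  also have "\<dots> = (cell_volume A)\<^sup>2 * (\<integral>z. indicator (cell A) z * (norm (p z))\<^sup>2 \<partial>lborel)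
      - 2 * cell_volume A * (\<integral>z. Re (indicator (cell A) z * (p z * cnj (q z))) \<partial>lborel) + (\<integral>z. indicator (cell A) z * (norm (q z))\<^sup>2 \<partial>lborel)"
    by (subst Bochner_Integration.integral_add Bochner_Integration.integral_diff,
        (intro Bochner_Integration.integrable_diff integrable_mult_right intp intr intq)+)+ simp
  also have "(\<integral>z. Re (indicator (cell A) z * (p z * cnj (q z))) \<partial>lborel) = S"
    using integral_Re[OF intc] cross by simp
  finally have "0 \<le> cell_volume A * (cell_volume A * (\<integral>z. indicator (cell A) z * (norm (p z))\<^sup>2 \<partial>lborel) - S)"
    unfolding q_int by (simp add: power2_eq_square algebra_simps)
  then show ?thesis
    using cell_volume_pos by (simp add: S_def \<beta>_def zero_le_mult_iff)
qed

end

section \<open>Two facts about unordered sums of reals\<close>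

text \<open>A two-sided inverse argument: \<open>a\<close> and \<open>c\<close> are both inverse to \<open>b\<close> under convolution, and summing
  \<open>a r * c m * b (s - r - m)\<close> over \<open>m\<close> first gives \<open>a s\<close>, over \<open>r\<close> first gives \<open>c s\<close>. The estimate
  \<open>2 * \<bar>c m * b t\<bar> \<le> (c m)\<^sup>2 + (b t)\<^sup>2\<close> makes the double family absolutely summable.\<close>

lemma convolution_inverse_unique:
  fixes a b c :: "'g::ab_group_add \<Rightarrow> real"
  assumes a: "(\<lambda>s. \<bar>a s\<bar>) summable_on UNIV" and b: "(\<lambda>s. (b s)\<^sup>2) summable_on UNIV"
    and c: "(\<lambda>s. (c s)\<^sup>2) summable_on UNIV"
    and ab: "\<And>s. ((\<lambda>m. a m * b (s - m)) has_sum (if s = 0 then 1 else 0)) UNIV"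
    and cb: "\<And>s. ((\<lambda>m. c m * b (s - m)) has_sum (if s = 0 then 1 else 0)) UNIV"
  shows "a = c"
proof
  fix s
  define f where "f = (\<lambda>(r, m). a r * c m * b (s - r - m))"
  define g where "g = (\<lambda>(r, m). \<bar>a r\<bar> * (((c m)\<^sup>2 + (b (s - r - m))\<^sup>2) / 2))"
  obtain B where B: "((\<lambda>s. (b s)\<^sup>2) has_sum B) UNIV" using b by (auto simp: summable_on_def)
  obtain C where C: "((\<lambda>s. (c s)\<^sup>2) has_sum C) UNIV" using c by (auto simp: summable_on_def)
  have "((\<lambda>m. g (r, m)) has_sum \<bar>a r\<bar> * ((C + B) / 2)) UNIV" for r
  proof -
    have "bij (\<lambda>m. s - r - m)"
      by (rule bij_betw_byWitness[where f'="\<lambda>m. s - r - m"]) auto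
    with B have "((\<lambda>m. (b (s - r - m))\<^sup>2) has_sum B) UNIV"
      by (subst has_sum_reindex_bij_betw[where f="\<lambda>m. (b m)\<^sup>2"])
    from has_sum_cmult_right[OF has_sum_add[OF C this], of "\<bar>a r\<bar> / 2"] show ?thesis
      by (simp add: g_def)
  qed
  moreover have "(\<lambda>r. \<bar>a r\<bar> * ((C + B) / 2)) summable_on UNIV"
    by (rule summable_on_cmult_left[OF a])
  ultimately have "g summable_on UNIV \<times> UNIV"
    by (rule summable_on_SigmaI) (simp add: g_def)
  then have "(\<lambda>x. norm (f x)) summable_on UNIV \<times> UNIV"
  proof (rule Infinite_Sum.abs_summable_on_comparison_test')
    fix x :: "'g \<times> 'g"
    obtain r m where x: "x = (r, m)" by (cases x)
    have "2 * (\<bar>c m\<bar> * \<bar>b (s - r - m)\<bar>) \<le> (c m)\<^sup>2 + (b (s - r - m))\<^sup>2"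
      using sum_squares_bound[of "\<bar>c m\<bar>" "\<bar>b (s - r - m)\<bar>"] by (simp add: mult.assoc)
    then have "\<bar>a r\<bar> * (\<bar>c m\<bar> * \<bar>b (s - r - m)\<bar>) \<le> \<bar>a r\<bar> * (((c m)\<^sup>2 + (b (s - r - m))\<^sup>2) / 2)"
      by (intro mult_left_mono) auto
    then show "norm (f x) \<le> g x"
      by (simp add: x f_def g_def abs_mult mult.assoc)
  qed
  then have "f summable_on UNIV \<times> UNIV"
    by (rule abs_summable_summable)
  then obtain S where S: "(f has_sum S) (UNIV \<times> UNIV)"
    by (auto simp: summable_on_def)
  have pick: "((\<lambda>r. d r * (if s - r = 0 then 1 else 0)) has_sum d s) UNIV" for d :: "'g \<Rightarrow> real"
    by (rule has_sum_finite_neutralI[of "{s}"]) auto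
  have "((\<lambda>r. a r * (if s - r = 0 then 1 else 0)) has_sum S) UNIV"
  proof (rule has_sum_SigmaD[OF S])
    show "((\<lambda>m. f (r, m)) has_sum a r * (if s - r = 0 then 1 else 0)) UNIV" for r
      using has_sum_cmult_right[OF cb[of "s - r"], of "a r"] by (simp add: f_def mult.assoc)
  qed
  then have "S = a s"
    using pick by (rule has_sum_unique)
  have "((f \<circ> prod.swap) has_sum S) (UNIV \<times> UNIV)"
    using S by (subst has_sum_reindex[symmetric]) (simp_all add: product_swap)
  then have "((\<lambda>m. c m * (if s - m = 0 then 1 else 0)) has_sum S) UNIV"
  proof (rule has_sum_SigmaD)
    show "((\<lambda>r. (f \<circ> prod.swap) (m, r)) has_sum c m * (if s - m = 0 then 1 else 0)) UNIV" for m
      using has_sum_cmult_right[OF ab[of "s - m"], of "c m"] by (simp add: f_def algebra_simps)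
  qed
  then have "S = c s"
    using pick by (rule has_sum_unique)
  with \<open>S = a s\<close> show "a s = c s" by simp
qed

text \<open>The mean \<open>t = S / W\<close> minimises the nonnegative sum of \<open>w i * (k i - t)\<^sup>2\<close>.\<close>

lemma weighted_cauchy_schwarz_has_sum:
  fixes w k :: "'i \<Rightarrow> real"
  assumes w: "\<And>i. 0 \<le> w i" and W: "(w has_sum W) UNIV"
    and S: "((\<lambda>i. w i * k i) has_sum S) UNIV" and Q: "((\<lambda>i. w i * (k i)\<^sup>2) has_sum Q) UNIV"
  shows "S\<^sup>2 \<le> W * Q"
proof (cases "W = 0")
  case True
  have "w i = 0" for i
    using finite_sum_le_has_sum[OF W, of "{i}"] w True by (intro antisym) auto
  then have "((\<lambda>i. w i * k i) has_sum 0) UNIV"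
    by (intro has_sum_0) simp
  then have "S = 0"
    using S by (rule has_sum_unique[rotated])
  then show ?thesis using True by simp
next
  case False
  then have "0 < W"
    using has_sum_nonneg[OF W] w by (auto simp: less_le)
  let ?t = "S / W"
  have "((\<lambda>i. w i * (k i)\<^sup>2 + (- 2 * ?t) * (w i * k i) + ?t\<^sup>2 * w i) has_sum (Q + (- 2 * ?t) * S + ?t\<^sup>2 * W)) UNIV"
    by (intro has_sum_add Q has_sum_cmult_right S W)
  also have "(\<lambda>i. w i * (k i)\<^sup>2 + (- 2 * ?t) * (w i * k i) + ?t\<^sup>2 * w i) = (\<lambda>i. w i * (k i - ?t)\<^sup>2)"
    by (intro ext) (simp only: power2_eq_square ring_distribs, simp add: algebra_simps)
  finally have "0 \<le> Q + (- 2 * ?t) * S + ?t\<^sup>2 * W"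
    by (rule has_sum_nonneg) (use w in auto)
  then have "0 \<le> (Q + (- 2 * ?t) * S + ?t\<^sup>2 * W) * W"
    using \<open>0 < W\<close> by simp
  also have "\<dots> = W * Q - S\<^sup>2"
    using \<open>0 < W\<close> by (simp add: power2_eq_square field_simps)
  finally show ?thesis by simp
qed

section \<open>The reciprocal of the periodized transform\<close>

locale cardinal_interpolation =
  fixes A :: "real ^ 'n ^ 'n"
    and K :: "real ^ 'n \<Rightarrow> real"
    and \<alpha> :: "int ^ 'n \<Rightarrow> complex"
  assumes A: "invertible A"
    and K_L2: "in_L2 (\<lambda>x. complex_of_real (K x))"
    and K_L1: "in_L1 (\<lambda>x. complex_of_real (K x))"
    and K_cont: "continuous_on UNIV K"
    and nonzero: "\<forall>z \<in> dual_map A ` unit_cube.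
        periodization A (fourier (\<lambda>x. complex_of_real (K x))) z \<noteq> 0"
    and fourier_series: "\<forall>z. ((\<lambda>s. \<alpha> s * exp (- \<i> * complex_of_real (lattice_pt A s \<bullet> z)))
        has_sum Upsilon A K z) UNIV"
    and integral_exists: "\<forall>x. integrable lebesgue
        (\<lambda>z. Upsilon A K z * fourier (\<lambda>x. complex_of_real (K x)) z *
             exp (\<i> * complex_of_real (z \<bullet> x)))"
begin

abbreviation FK :: "real ^ 'n \<Rightarrow> complex" where "FK \<equiv> fourier (\<lambda>x. complex_of_real (K x))"
abbreviation U :: "real ^ 'n \<Rightarrow> complex" where "U \<equiv> Upsilon A K"
abbreviation P :: "real ^ 'n \<Rightarrow> complex" where "P \<equiv> periodization A FK"

lemma K_borel [measurable]: "K \<in> borel_measurable borel"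
  by (rule borel_measurable_continuous_onI[OF K_cont])

lemma K_integrable: "integrable lborel (\<lambda>x. complex_of_real (K x))"
  using K_L1 unfolding in_L1_def by (subst (asm) integrable_completion) auto

lemma K_square_integrable: "integrable lborel (\<lambda>x. (K x)\<^sup>2)"
  using K_L2 unfolding in_L2_def by (subst (asm) integrable_completion) auto

lemma continuous_on_FK: "continuous_on S FK"
  using isCont_fourier[OF K_integrable] by (intro continuous_at_imp_continuous_on) auto

lemma FK_borel [measurable]: "FK \<in> borel_measurable borel"
  by (rule borel_measurable_continuous_onI[OF continuous_on_FK])

lemma U_has_sum: "((\<lambda>s. \<alpha> s * cnj (lattice_char A s z)) has_sum U z) UNIV"
  using fourier_series by (simp only: exp_eq_cnj_lattice_char)

lemma \<alpha>_summable: "(\<lambda>s. norm (\<alpha> s)) summable_on UNIV"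
proof -
  have "(\<lambda>s. norm (\<alpha> s * cnj (lattice_char A s 0))) summable_on UNIV"
    using U_has_sum[of 0] by (metis has_sum_imp_summable summable_on_iff_abs_summable_on_complex)
  then show ?thesis
    by (simp add: lattice_char_simps)
qed

lemma continuous_on_U: "continuous_on S U"
proof -
  have "uniform_limit UNIV (\<lambda>F z. \<Sum>s\<in>F. \<alpha> s * cnj (lattice_char A s z)) U (finite_subsets_at_top UNIV)"
    by (rule Weierstrass_m_test_general'[OF _ U_has_sum \<alpha>_summable]) (simp add: norm_mult lattice_char_simps)
  then have "continuous_on UNIV U"
    by (rule uniform_limit_theorem[rotated])
       (auto intro!: always_eventually continuous_intros simp: lattice_char_def[abs_def])
  then show ?thesis
    by (rule continuous_on_subset) simp
qed

lemma U_borel [measurable]: "U \<in> borel_measurable borel"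
  by (rule borel_measurable_continuous_onI[OF continuous_on_U])

lemma U_periodic: "U (z + dual_pt A m) = U z"
  using U_has_sum[of "z + dual_pt A m"] U_has_sum[of z]
  by (simp add: lattice_char_simps lattice_char_periodic[OF A] has_sum_unique)

text \<open>A compact period domain, on which continuous functions attain their bounds.\<close>

definition closed_cell :: "(real ^ 'n) set" where "closed_cell = dual_map A ` unit_cube"

lemma compact_closed_cell: "compact closed_cell"
proof -
  have "unit_cube = cbox (0 :: real ^ 'n) 1"
    by (auto simp: unit_cube_def mem_box_cart)
  then have "compact (unit_cube :: (real ^ 'n) set)"
    by (metis compact_cbox)
  moreover have "continuous_on unit_cube (dual_map A)"
    unfolding dual_map_def by (intro continuous_intros)
  ultimately show ?thesis
    unfolding closed_cell_def by (rule compact_continuous_image[rotated])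
qed

lemma cell_subset_closed_cell: "cell A \<subseteq> closed_cell"
proof
  fix z assume "z \<in> cell A"
  then have "dual_coord A z \<in> unit_cube"
    by (auto simp: cell_def unit_cube_def less_imp_le)
  then show "z \<in> closed_cell"
    unfolding closed_cell_def using dual_map_dual_coord[OF A, of z] by (metis imageI)
qed

lemma translate_into_cell: "z + dual_pt A (- tile_index A z) \<in> cell A"
  by (simp add: cell_translate_iff'[OF A] del: int_vec_simps)

text \<open>The periodization is only known to be nonzero on one closed period parallelotope. Since division by
  zero yields \<open>0\<close>, the periodicity of \<open>\<Upsilon>\<close> carries this over to all points.\<close>

lemma U_nonzero: "U z \<noteq> 0"
proof -
  have "P (z + dual_pt A (- tile_index A z)) \<noteq> 0"
    using subsetD[OF cell_subset_closed_cell translate_into_cell, of z]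
    unfolding closed_cell_def by (rule bspec[OF nonzero])
  then have "U (z + dual_pt A (- tile_index A z)) \<noteq> 0"
    by (simp add: Upsilon_def del: int_vec_simps)
  then show ?thesis
    unfolding U_periodic .
qed

lemma P_eq: "P z = 1 / U z"
  by (simp add: Upsilon_def)

lemma P_nonzero: "P z \<noteq> 0"
  using U_nonzero[of z] by (simp add: P_eq)

lemma P_borel [measurable]: "P \<in> borel_measurable borel"
  unfolding P_eq[abs_def] by measurable

text \<open>A divergent unordered sum has the value \<open>0\<close>, so a nonzero periodization converges.\<close>

lemma P_has_sum: "((\<lambda>m. FK (z + dual_pt A m)) has_sum P z) UNIV"
proof -
  have "(\<lambda>m. FK (z + dual_pt A m)) summable_on UNIV"
    using P_nonzero[of z] unfolding periodization_def by (metis infsum_not_exists)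
  then show ?thesis
    unfolding periodization_def by (rule has_sum_infsum)
qed

lemma U_bounded_below: obtains \<epsilon> where "\<epsilon> > 0" and "\<And>z. \<epsilon> \<le> norm (U z)"
proof -
  have "continuous_on closed_cell (\<lambda>z. norm (U z))"
    by (intro continuous_intros continuous_on_U)
  moreover have "closed_cell \<noteq> {}"
    using translate_into_cell cell_subset_closed_cell by auto
  ultimately obtain z0 where z0: "\<And>z. z \<in> closed_cell \<Longrightarrow> norm (U z0) \<le> norm (U z)"
    using continuous_attains_inf[OF compact_closed_cell, of "\<lambda>z. norm (U z)"] by auto
  show thesis
  proof
    show "norm (U z0) > 0" using U_nonzero by simp
    fix z
    have "norm (U z0) \<le> norm (U (z + dual_pt A (- tile_index A z)))"
      using translate_into_cell cell_subset_closed_cell by (intro z0) auto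
    then show "norm (U z0) \<le> norm (U z)"
      by (simp only: U_periodic)
  qed
qed

lemma integrable_U_FK: "integrable lborel (\<lambda>z. U z * FK z * exp (\<i> * complex_of_real (z \<bullet> x)))"
  using integral_exists by (subst (asm) integrable_completion) auto

text \<open>The factor \<open>\<Upsilon>\<close> is bounded away from zero and can be divided out of the integrable function
  \<open>\<Upsilon> F K\<close>. This is what makes pointwise inversion for \<open>K\<close> available.\<close>

lemma FK_integrable: "integrable lborel FK"
proof -
  obtain \<epsilon> where \<epsilon>: "\<epsilon> > 0" and U: "\<And>z. \<epsilon> \<le> norm (U z)" by (rule U_bounded_below) blast
  have "integrable lborel (\<lambda>z. norm (U z * FK z) / \<epsilon>)"
    using integrable_U_FK[of 0] by (intro integrable_divide integrable_norm) simp
  then show ?thesis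
  proof (rule Bochner_Integration.integrable_bound)
    show "AE z in lborel. norm (FK z) \<le> norm (norm (U z * FK z) / \<epsilon>)"
    proof (rule AE_I2)
      fix z
      have "\<epsilon> * norm (FK z) \<le> norm (U z) * norm (FK z)"
        using U by (intro mult_right_mono) auto
      then show "norm (FK z) \<le> norm (norm (U z * FK z) / \<epsilon>)"
        using \<epsilon> by (simp add: norm_mult field_simps)
    qed
  qed measurable
qed

lemma continuous_on_Kc: "continuous_on UNIV (\<lambda>x. complex_of_real (K x))"
  by (intro continuous_intros K_cont)

lemma K_inversion:
  "(\<integral>z. FK z * exp (\<i> * complex_of_real (z \<bullet> x)) \<partial>lborel) = complex_of_real ((2 * pi) ^ CARD('n)) * complex_of_real (K x)"
  by (rule fourier_inversion[OF continuous_on_Kc K_integrable FK_integrable])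

lemma K_bounded: obtains C where "\<And>x. \<bar>K x\<bar> \<le> C"
  using bounded_if_fourier_integrable[OF continuous_on_Kc K_integrable FK_integrable] that by auto

lemma FK_minus: "FK (- z) = cnj (FK z)"
  by (subst fourier_cnj_lborel, simp, subst fourier_lborel) simp_all

lemma U_minus: "U (- z) = cnj (U z)"
proof -
  have "((\<lambda>m. cnj (FK (z + dual_pt A m))) has_sum cnj (P z)) UNIV"
    using P_has_sum by simp
  then have "((\<lambda>m. FK (- z + dual_pt A (- m))) has_sum cnj (P z)) UNIV"
    by (simp add: FK_minus[symmetric] dual_map_simps)
  then have "((\<lambda>m. FK (- z + dual_pt A m)) has_sum cnj (P z)) UNIV"
    using has_sum_reindex_bij_betw[OF bij_uminus, of "\<lambda>m. FK (- z + dual_pt A m)"] by blast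
  then have "P (- z) = cnj (P z)"
    using P_has_sum by (rule has_sum_unique[rotated])
  then show ?thesis
    by (simp add: Upsilon_def)
qed

text \<open>Since \<open>K\<close> is real, \<open>\<Upsilon> (- z) = cnj (\<Upsilon> z)\<close>. So the conjugate coefficients represent \<open>\<Upsilon>\<close> as well, and
  coefficients are unique.\<close>

lemma \<alpha>_real: "\<alpha> s = complex_of_real (Re (\<alpha> s))"
proof -
  have "((\<lambda>s. cnj (\<alpha> s) * cnj (lattice_char A s z)) has_sum U z) UNIV" for z
  proof -
    have "((\<lambda>s. cnj (\<alpha> s * cnj (lattice_char A s (- z)))) has_sum cnj (U (- z))) UNIV"
      using U_has_sum by (simp only: has_sum_cnj_iff)
    then show ?thesis
      by (simp add: U_minus lattice_char_simps)
  qed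
  from fourier_coefficient[OF A this] fourier_coefficient[OF A U_has_sum]
  have "complex_of_real (cell_volume A) * cnj (\<alpha> s) = complex_of_real (cell_volume A) * \<alpha> s"
    by metis
  then have "cnj (\<alpha> s) = \<alpha> s"
    using cell_volume_pos[OF A] by simp
  then show ?thesis
    by (simp add: complex_eq_iff)
qed

section \<open>The fundamental spline\<close>

definition coeff :: "int ^ 'n \<Rightarrow> real" where "coeff s = \<bar>det A\<bar> * Re (\<alpha> s)"

lemma coeff_summable: "(\<lambda>s. \<bar>coeff s\<bar>) summable_on UNIV"
proof -
  have "(\<lambda>s. \<bar>det A\<bar> * norm (\<alpha> s)) summable_on UNIV"
    by (intro summable_on_cmult_right \<alpha>_summable)
  also have "(\<lambda>s. \<bar>det A\<bar> * norm (\<alpha> s)) = (\<lambda>s. \<bar>coeff s\<bar>)"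
    by (subst \<alpha>_real) (simp add: coeff_def abs_mult)
  finally show ?thesis .
qed

lemma sk_tilde_lborel: "sk_tilde A K x = complex_of_real (\<bar>det A\<bar> / (2 * pi) ^ CARD('n)) *
    (\<integral>z. U z * FK z * exp (\<i> * complex_of_real (z \<bullet> x)) \<partial>lborel)"
  unfolding sk_tilde_def by (subst integral_completion) auto

text \<open>Termwise inversion: the term \<open>\<alpha> s * exp (- \<i> * (A s \<bullet> z))\<close> of \<open>\<Upsilon>\<close> contributes \<open>K\<close> shifted to the lattice
  point \<open>A s\<close>.\<close>

lemma sk_tilde_has_sum:
  "((\<lambda>s. complex_of_real (coeff s * K (x - lattice_pt A s))) has_sum sk_tilde A K x) UNIV"
proof -
  let ?f = "\<lambda>s z. \<alpha> s * (FK z * exp (\<i> * complex_of_real (z \<bullet> (x - lattice_pt A s))))"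
  have "((\<lambda>s. \<integral>z. ?f s z \<partial>lborel) has_sum (\<integral>z. U z * FK z * exp (\<i> * complex_of_real (z \<bullet> x)) \<partial>lborel)) UNIV"
  proof (rule integral_has_sum(2))
    have "integrable lborel (\<lambda>z. FK z * exp (\<i> * complex_of_real (z \<bullet> w)))" for w
      by (rule Bochner_Integration.integrable_bound[OF FK_integrable]) (measurable, simp add: norm_mult)
    then show "integrable lborel (?f s)" for s
      by (intro integrable_mult_right)
    have "(\<lambda>s. norm (\<alpha> s) * (\<integral>z. norm (FK z) \<partial>lborel)) summable_on UNIV"
      by (intro summable_on_cmult_left \<alpha>_summable)
    then show "(\<lambda>s. \<integral>z. norm (?f s z) \<partial>lborel) summable_on UNIV"
      by (simp add: norm_mult)
    fix z
    have "exp (\<i> * complex_of_real (z \<bullet> (x - lattice_pt A s))) =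
        cnj (lattice_char A s z) * exp (\<i> * complex_of_real (z \<bullet> x))" for s
      by (simp add: lattice_char_def exp_cnj exp_add[symmetric] inner_diff_right inner_commute algebra_simps)
    then show "((\<lambda>s. ?f s z) has_sum U z * FK z * exp (\<i> * complex_of_real (z \<bullet> x))) UNIV"
      using has_sum_cmult_left[OF U_has_sum, of z "FK z * exp (\<i> * complex_of_real (z \<bullet> x))"]
      by (simp add: ac_simps)
  qed
  from has_sum_cmult_right[OF this, of "complex_of_real (\<bar>det A\<bar> / (2 * pi) ^ CARD('n))"]
  have "((\<lambda>s. complex_of_real (\<bar>det A\<bar> / (2 * pi) ^ CARD('n)) * (\<integral>z. ?f s z \<partial>lborel)) has_sum sk_tilde A K x) UNIV"
    unfolding sk_tilde_lborel .
  also have "(\<lambda>s. complex_of_real (\<bar>det A\<bar> / (2 * pi) ^ CARD('n)) * (\<integral>z. ?f s z \<partial>lborel))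
      = (\<lambda>s. complex_of_real (coeff s * K (x - lattice_pt A s)))"
  proof
    fix s
    have "(\<integral>z. ?f s z \<partial>lborel) = complex_of_real (Re (\<alpha> s)) * (complex_of_real ((2 * pi) ^ CARD('n)) * complex_of_real (K (x - lattice_pt A s)))"
      unfolding integral_mult_right_zero K_inversion using \<alpha>_real[of s] by simp
    then show "complex_of_real (\<bar>det A\<bar> / (2 * pi) ^ CARD('n)) * (\<integral>z. ?f s z \<partial>lborel)
        = complex_of_real (coeff s * K (x - lattice_pt A s))"
      by (simp add: coeff_def)
  qed
  finally show ?thesis .
qed

lemma K_translate:
  shows "integrable lborel (\<lambda>x. complex_of_real (K (x - w)))"
    and "integrable lborel (\<lambda>x. (K (x - w))\<^sup>2)"
    and "(\<integral>x. (K (x - w))\<^sup>2 \<partial>lborel) = (\<integral>x. (K x)\<^sup>2 \<partial>lborel)"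
    and "(\<integral>x. \<bar>K (x - w)\<bar> \<partial>lborel) = (\<integral>x. \<bar>K x\<bar> \<partial>lborel)"
  using integrable_lborel_affine[OF K_integrable, of 1 "- w"] integrable_lborel_affine[OF K_square_integrable, of 1 "- w"]
    integral_lborel_affine[of "\<lambda>x. (K x)\<^sup>2" 1 "- w"] integral_lborel_affine[of "\<lambda>x. \<bar>K x\<bar>" 1 "- w"]
  by simp_all

text \<open>Minkowski's inequality for infinitely many translates of \<open>K\<close>. The Cauchy-Schwarz inequality with
  weights \<open>\<bar>c m\<bar>\<close> bounds the square of the sum pointwise by \<open>W\<close> times a series that can be integrated
  term by term. Boundedness of \<open>K\<close> is what makes that series converge at every point.\<close>

lemma spline_L2_bound:
  assumes c: "((\<lambda>m. \<bar>c m\<bar>) has_sum W) UNIV"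
    and f: "\<And>x. ((\<lambda>m. c m * K (x - lattice_pt A m)) has_sum f x) UNIV"
  shows "f \<in> borel_measurable borel" and "integrable lborel (\<lambda>x. (f x)\<^sup>2)"
    and "(\<integral>x. (f x)\<^sup>2 \<partial>lborel) \<le> W\<^sup>2 * (\<integral>x. (K x)\<^sup>2 \<partial>lborel)"
proof -
  obtain C where C: "\<And>x. \<bar>K x\<bar> \<le> C" by (rule K_bounded) blast
  have cs: "(\<lambda>m. \<bar>c m\<bar>) summable_on UNIV"
    using c by (rule has_sum_imp_summable)
  have "integrable lborel (\<lambda>x. complex_of_real (f x))"
  proof (rule integral_has_sum(1))
    show "((\<lambda>m. complex_of_real (c m) * complex_of_real (K (x - lattice_pt A m))) has_sum complex_of_real (f x)) UNIV" for x
      using has_sum_of_real[OF f[of x], where 'a=complex] by simp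
    have "(\<lambda>m. \<bar>c m\<bar> * (\<integral>x. \<bar>K x\<bar> \<partial>lborel)) summable_on UNIV"
      by (intro summable_on_cmult_left cs)
    then show "(\<lambda>m. \<integral>x. norm (complex_of_real (c m) * complex_of_real (K (x - lattice_pt A m))) \<partial>lborel) summable_on UNIV"
      by (simp add: norm_mult K_translate)
  qed (intro integrable_mult_right K_translate(1))
  then have "(\<lambda>x. Re (complex_of_real (f x))) \<in> borel_measurable lborel"
    by (intro borel_measurable_integrable[OF integrable_Re])
  then show f_borel [measurable]: "f \<in> borel_measurable borel"
    by simp
  define q where "q x = (\<Sum>\<^sub>\<infinity>m. \<bar>c m\<bar> * (K (x - lattice_pt A m))\<^sup>2)" for x
  have q: "((\<lambda>m. \<bar>c m\<bar> * (K (x - lattice_pt A m))\<^sup>2) has_sum q x) UNIV" for x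
  proof -
    have "(\<lambda>m. norm (\<bar>c m\<bar> * (K (x - lattice_pt A m))\<^sup>2)) summable_on UNIV"
    proof (rule Infinite_Sum.abs_summable_on_comparison_test')
      show "(\<lambda>m. \<bar>c m\<bar> * C\<^sup>2) summable_on UNIV"
        by (intro summable_on_cmult_left cs)
      show "norm (\<bar>c m\<bar> * (K (x - lattice_pt A m))\<^sup>2) \<le> \<bar>c m\<bar> * C\<^sup>2" for m
        using power_mono[OF C[of "x - lattice_pt A m"] abs_ge_zero, of 2]
        by (simp add: abs_mult mult_left_mono)
    qed
    then show ?thesis
      unfolding q_def by (rule has_sum_infsum[OF abs_summable_summable])
  qed
  let ?g = "\<lambda>m x. complex_of_real (\<bar>c m\<bar>) * complex_of_real ((K (x - lattice_pt A m))\<^sup>2)"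
  have int_g: "integrable lborel (?g m)" for m
    by (intro integrable_mult_right integrable_of_real K_translate(2))
  have norm_g: "(\<integral>x. norm (?g m x) \<partial>lborel) = \<bar>c m\<bar> * (\<integral>x. (K x)\<^sup>2 \<partial>lborel)" for m
    unfolding norm_mult norm_of_real by (simp add: K_translate)
  have val_g: "(\<integral>x. ?g m x \<partial>lborel) = complex_of_real (\<bar>c m\<bar> * (\<integral>x. (K x)\<^sup>2 \<partial>lborel))" for m
    unfolding integral_mult_right_zero integral_complex_of_real K_translate by simp
  have sum_g: "(\<lambda>m. \<integral>x. norm (?g m x) \<partial>lborel) summable_on UNIV"
    unfolding norm_g by (intro summable_on_cmult_left cs)
  have has_g: "((\<lambda>m. ?g m x) has_sum complex_of_real (q x)) UNIV" for x
    using has_sum_of_real[OF q[of x], where 'a=complex] by (simp only: of_real_mult)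
  note G = integral_has_sum[OF int_g sum_g has_g]
  have q_int: "integrable lborel q"
    using G(1) by (simp only: complex_of_real_integrable_eq)
  have "((\<lambda>m. complex_of_real (\<bar>c m\<bar> * (\<integral>x. (K x)\<^sup>2 \<partial>lborel))) has_sum complex_of_real (\<integral>x. q x \<partial>lborel)) UNIV"
    using G(2) by (simp only: val_g integral_complex_of_real)
  then have "((\<lambda>m. \<bar>c m\<bar> * (\<integral>x. (K x)\<^sup>2 \<partial>lborel)) has_sum (\<integral>x. q x \<partial>lborel)) UNIV"
    by (simp only: has_sum_of_real_iff)
  then have q_val: "(\<integral>x. q x \<partial>lborel) = W * (\<integral>x. (K x)\<^sup>2 \<partial>lborel)"
    using has_sum_cmult_left[OF c] by (rule has_sum_unique)
  have bound: "(f x)\<^sup>2 \<le> W * q x" for x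
  proof (rule weighted_cauchy_schwarz_has_sum)
    show "((\<lambda>m. \<bar>c m\<bar> * (sgn (c m) * K (x - lattice_pt A m))) has_sum f x) UNIV"
      using f[of x] by (simp add: mult.assoc[symmetric] abs_mult_sgn)
    have "\<bar>c m\<bar> * (sgn (c m) * K (x - lattice_pt A m))\<^sup>2 = \<bar>c m\<bar> * (K (x - lattice_pt A m))\<^sup>2" for m
      by (cases "c m" "0 :: real" rule: linorder_cases) auto
    then show "((\<lambda>m. \<bar>c m\<bar> * (sgn (c m) * K (x - lattice_pt A m))\<^sup>2) has_sum q x) UNIV"
      using q[of x] by (simp only:)
  qed (use c in auto)
  show f2: "integrable lborel (\<lambda>x. (f x)\<^sup>2)"
  proof (rule Bochner_Integration.integrable_bound)
    show "integrable lborel (\<lambda>x. W * q x)"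
      using q_int by simp
    show "AE x in lborel. norm ((f x)\<^sup>2) \<le> norm (W * q x)"
      using bound by (auto intro: order_trans[OF _ abs_ge_self])
  qed measurable
  have "(\<integral>x. (f x)\<^sup>2 \<partial>lborel) \<le> (\<integral>x. W * q x \<partial>lborel)"
    by (intro integral_mono f2 bound) (use q_int in simp)
  then show "(\<integral>x. (f x)\<^sup>2 \<partial>lborel) \<le> W\<^sup>2 * (\<integral>x. (K x)\<^sup>2 \<partial>lborel)"
    by (simp add: q_val power2_eq_square mult.assoc)
qed

text \<open>The remainder after a finite set \<open>F\<close> is itself a spline, with the coefficients in \<open>F\<close> set to zero, so
  the previous bound makes its norm at most the corresponding tail of \<open>\<Sum>\<bar>c m\<bar>\<close>, up to a constant factor.\<close>

lemma absolutely_summable_spline: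
  assumes c: "(\<lambda>m. \<bar>c m\<bar>) summable_on UNIV"
    and f: "\<And>x. ((\<lambda>m. complex_of_real (c m * K (x - lattice_pt A m))) has_sum f x) UNIV"
  shows "in_L2 f" and "sk_series A K c f"
proof -
  define W where "W = (\<Sum>\<^sub>\<infinity>m. \<bar>c m\<bar>)"
  have W: "((\<lambda>m. \<bar>c m\<bar>) has_sum W) UNIV"
    unfolding W_def by (rule has_sum_infsum[OF c])
  define r where "r x = Re (f x)" for x
  have f_eq: "f x = complex_of_real (r x)" and r: "((\<lambda>m. c m * K (x - lattice_pt A m)) has_sum r x) UNIV" for x
  proof -
    show r: "((\<lambda>m. c m * K (x - lattice_pt A m)) has_sum r x) UNIV"
      using has_sum_Re[OF f[of x]] by (simp add: r_def)
    show "f x = complex_of_real (r x)"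
      using f[of x] has_sum_of_real[OF r] by (rule has_sum_unique)
  qed
  note R = spline_L2_bound[OF W r]
  have [measurable]: "f \<in> borel_measurable borel"
    unfolding f_eq[abs_def] using R(1) by measurable
  show "in_L2 f"
    unfolding in_L2_def
  proof
    show "f \<in> borel_measurable lebesgue"
      by (rule measurable_completion) simp
    show "integrable lebesgue (\<lambda>x. (norm (f x))\<^sup>2)"
      using R(2) by (subst integrable_completion) (simp_all add: f_eq)
  qed
  let ?N = "\<integral>x. (K x)\<^sup>2 \<partial>lborel"
  let ?e = "\<lambda>F. \<integral>\<^sup>+x. ennreal ((norm (f x - (\<Sum>m\<in>F. complex_of_real (c m * K (x - lattice_pt A m)))))\<^sup>2) \<partial>lebesgue"
  have e: "?e F \<le> ennreal ((W - (\<Sum>m\<in>F. \<bar>c m\<bar>))\<^sup>2 * ?N)" if F: "finite F" for F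
  proof -
    let ?c = "\<lambda>m. if m \<in> F then 0 else c m"
    have W': "((\<lambda>m. \<bar>?c m\<bar>) has_sum (W - (\<Sum>m\<in>F. \<bar>c m\<bar>))) UNIV"
    proof -
      have "((\<lambda>m. \<bar>c m\<bar>) has_sum (W - (\<Sum>m\<in>F. \<bar>c m\<bar>))) (UNIV - F)"
        using F by (intro has_sum_Diff W has_sum_finite) auto
      then show ?thesis
        by (rule has_sum_cong_neutral[THEN iffD1, rotated -1]) auto
    qed
    have r': "((\<lambda>m. ?c m * K (x - lattice_pt A m)) has_sum (r x - (\<Sum>m\<in>F. c m * K (x - lattice_pt A m)))) UNIV" for x
    proof -
      have "((\<lambda>m. c m * K (x - lattice_pt A m)) has_sum (r x - (\<Sum>m\<in>F. c m * K (x - lattice_pt A m)))) (UNIV - F)"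
        using F by (intro has_sum_Diff r has_sum_finite) auto
      then show ?thesis
        by (rule has_sum_cong_neutral[THEN iffD1, rotated -1]) auto
    qed
    note R' = spline_L2_bound[OF W' r']
    have "?e F = (\<integral>\<^sup>+x. ennreal ((r x - (\<Sum>m\<in>F. c m * K (x - lattice_pt A m)))\<^sup>2) \<partial>lborel)"
      unfolding nn_integral_completion f_eq
      by (simp only: of_real_sum[symmetric] of_real_diff[symmetric] norm_of_real power2_abs)
    also have "\<dots> = ennreal (\<integral>x. (r x - (\<Sum>m\<in>F. c m * K (x - lattice_pt A m)))\<^sup>2 \<partial>lborel)"
      by (rule nn_integral_eq_integral[OF R'(2)]) simp
    also have "\<dots> \<le> ennreal ((W - (\<Sum>m\<in>F. \<bar>c m\<bar>))\<^sup>2 * ?N)"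
      by (intro ennreal_leI R'(3))
    finally show ?thesis .
  qed
  have "((\<lambda>F. ennreal ((W - (\<Sum>m\<in>F. \<bar>c m\<bar>))\<^sup>2 * ?N)) \<longlongrightarrow> ennreal ((W - W)\<^sup>2 * ?N)) (finite_subsets_at_top UNIV)"
    using W unfolding has_sum_def by (intro tendsto_ennrealI tendsto_intros)
  then have lim: "((\<lambda>F. ennreal ((W - (\<Sum>m\<in>F. \<bar>c m\<bar>))\<^sup>2 * ?N)) \<longlongrightarrow> 0) (finite_subsets_at_top UNIV)"
    by simp
  have "(?e \<longlongrightarrow> 0) (finite_subsets_at_top UNIV)"
  proof (rule tendsto_sandwich[OF _ _ tendsto_const lim])
    show "\<forall>\<^sub>F F in finite_subsets_at_top UNIV. ?e F \<le> ennreal ((W - (\<Sum>m\<in>F. \<bar>c m\<bar>))\<^sup>2 * ?N)"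
      using e by (intro eventually_finite_subsets_at_top_weakI)
  qed simp
  then show "sk_series A K c f"
    unfolding sk_series_def using f by simp
qed

text \<open>Folding \<open>\<Upsilon> F K\<close> times a character onto the cell leaves \<open>\<Upsilon> P = 1\<close> times the character.\<close>

lemma sk_tilde_at_lattice: "sk_tilde A K (lattice_pt A s) = (if s = 0 then 1 else 0)"
proof -
  have exp_char: "exp (\<i> * complex_of_real (z \<bullet> lattice_pt A s)) = lattice_char A s z" for z
    by (simp add: lattice_char_def inner_commute)
  have "((\<lambda>m. U (z + dual_pt A m) * FK (z + dual_pt A m) * lattice_char A s (z + dual_pt A m)) has_sum lattice_char A s z) UNIV" for z
    using has_sum_cmult_right[OF P_has_sum[of z], of "U z * lattice_char A s z"] U_nonzero[of z]
    by (simp add: U_periodic lattice_char_simps lattice_char_periodic[OF A] P_eq ac_simps)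
  from unfold_over_dual_lattice(2)[OF A integrable_U_FK[of "lattice_pt A s", unfolded exp_char] this]
  have "(\<integral>z. U z * FK z * lattice_char A s z \<partial>lborel) = (if s = 0 then complex_of_real (cell_volume A) else 0)"
    by (simp only: integral_lattice_char[OF A])
  moreover have "\<bar>det A\<bar> / (2 * pi) ^ CARD('n) * cell_volume A = 1"
    using A by (simp add: cell_volume_def invertible_det_nz)
  ultimately show ?thesis
    unfolding sk_tilde_lborel exp_char by (simp only: of_real_mult[symmetric] split: if_split) simp
qed

lemma sk_tilde_fundamental: "fundamental_sk_spline A K (sk_tilde A K)"
  using absolutely_summable_spline[OF coeff_summable sk_tilde_has_sum] sk_tilde_at_lattice
  unfolding fundamental_sk_spline_def SK_def by auto

section \<open>Uniqueness\<close>

text \<open>By folding and inversion, \<open>(2 * pi) ^ n * K (A s)\<close> is the integral over the cell of the bounded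
  function \<open>P\<close> against a character, and Bessel's inequality applies.\<close>

lemma kernel_samples_square_summable: "(\<lambda>s. (K (lattice_pt A s))\<^sup>2) summable_on UNIV"
proof (rule nonneg_bdd_above_summable_on)
  obtain \<epsilon> where \<epsilon>: "\<epsilon> > 0" and U: "\<And>z. \<epsilon> \<le> norm (U z)" by (rule U_bounded_below) blast
  have P: "norm (P z) \<le> 1 / \<epsilon>" for z
    using \<epsilon> U[of z] by (simp add: P_eq norm_divide frac_le)
  have coef: "(\<integral>z. indicator (cell A) z * (P z * lattice_char A s z) \<partial>lborel)
      = complex_of_real ((2 * pi) ^ CARD('n) * K (lattice_pt A s))" for s
  proof -
    have exp_char: "exp (\<i> * complex_of_real (z \<bullet> lattice_pt A s)) = lattice_char A s z" for z
      by (simp add: lattice_char_def inner_commute)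
    have "integrable lborel (\<lambda>z. FK z * lattice_char A s z)"
      by (rule Bochner_Integration.integrable_bound[OF FK_integrable]) (measurable, simp add: norm_mult lattice_char_simps)
    moreover have "((\<lambda>m. FK (z + dual_pt A m) * lattice_char A s (z + dual_pt A m)) has_sum P z * lattice_char A s z) UNIV" for z
      using has_sum_cmult_left[OF P_has_sum[of z], of "lattice_char A s z"]
      by (simp add: lattice_char_simps lattice_char_periodic[OF A])
    ultimately show ?thesis
      using unfold_over_dual_lattice(2)[OF A] K_inversion[of "lattice_pt A s"] by (simp add: exp_char)
  qed
  let ?B = "cell_volume A * (\<integral>z. indicator (cell A) z * (norm (P z))\<^sup>2 \<partial>lborel)"
  show "bdd_above (sum (\<lambda>s. (K (lattice_pt A s))\<^sup>2) ` {F. F \<subseteq> UNIV \<and> finite F})"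
  proof (rule bdd_aboveI2)
    fix F :: "(int ^ 'n) set" assume "F \<in> {F. F \<subseteq> UNIV \<and> finite F}"
    then have "(\<Sum>s\<in>F. (norm (complex_of_real ((2 * pi) ^ CARD('n) * K (lattice_pt A s))))\<^sup>2) \<le> ?B"
      using bessel_inequality[OF A P_borel P, of F] by (simp only: coef) simp
    also have "(\<Sum>s\<in>F. (norm (complex_of_real ((2 * pi) ^ CARD('n) * K (lattice_pt A s))))\<^sup>2)
        = ((2 * pi) ^ CARD('n))\<^sup>2 * (\<Sum>s\<in>F. (K (lattice_pt A s))\<^sup>2)"
      unfolding norm_of_real power2_abs power_mult_distrib by (rule sum_distrib_left[symmetric])
    finally show "(\<Sum>s\<in>F. (K (lattice_pt A s))\<^sup>2) \<le> ?B / ((2 * pi) ^ CARD('n))\<^sup>2"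
      by (simp add: field_simps)
  qed
qed simp

text \<open>Where \<open>P\<close> does not vanish, neither does some term of its series. The open sets on which a given
  term is nonzero thus cover the compact period domain, and finitely many terms suffice.\<close>

lemma FK_tiles_bounded_below:
  obtains M \<eta> where "finite M" and "\<eta> > 0" and "\<And>z. z \<in> cell A \<Longrightarrow> \<eta> \<le> (\<Sum>m\<in>M. (norm (FK (z + dual_pt A m)))\<^sup>2)"
proof -
  have open_W: "open {z. FK (z + dual_pt A m) \<noteq> 0}" for m
    by (intro open_Collect_neq continuous_on_compose2[OF continuous_on_FK] continuous_intros) auto
  have "closed_cell \<subseteq> (\<Union>m\<in>UNIV. {z. FK (z + dual_pt A m) \<noteq> 0})"
  proof (rule subsetI, rule ccontr)
    fix z assume "z \<notin> (\<Union>m\<in>UNIV. {z. FK (z + dual_pt A m) \<noteq> 0})"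
    then have "((\<lambda>m. FK (z + dual_pt A m)) has_sum 0) UNIV"
      by (intro has_sum_0) auto
    then show False
      using P_nonzero P_has_sum has_sum_unique by blast
  qed
  with compact_closed_cell open_W obtain M
    where M: "finite M" "closed_cell \<subseteq> (\<Union>m\<in>M. {z. FK (z + dual_pt A m) \<noteq> 0})"
    by (rule compactE_image) auto
  let ?g = "\<lambda>z. \<Sum>m\<in>M. (norm (FK (z + dual_pt A m)))\<^sup>2"
  have "continuous_on closed_cell ?g"
    by (intro continuous_intros continuous_on_compose2[OF continuous_on_FK]) auto
  moreover have "closed_cell \<noteq> {}"
    using translate_into_cell cell_subset_closed_cell by auto
  ultimately obtain z0 where z0: "z0 \<in> closed_cell" "\<And>z. z \<in> closed_cell \<Longrightarrow> ?g z0 \<le> ?g z"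
    using continuous_attains_inf[OF compact_closed_cell, of ?g] by auto
  obtain m where m: "m \<in> M" "FK (z0 + dual_pt A m) \<noteq> 0"
    using z0(1) M(2) by auto
  show thesis
  proof (rule that[OF M(1)])
    show "0 < ?g z0"
      by (rule sum_pos2[OF M(1) m(1)]) (use m(2) in auto)
    show "?g z0 \<le> ?g z" if "z \<in> cell A" for z
      using that cell_subset_closed_cell z0(2) by auto
  qed
qed

text \<open>The transform of the finite spline is \<open>F K\<close> times a periodic trigonometric polynomial \<open>T\<close> with the
  coefficients \<open>c\<close>. Restricting the integral of \<open>\<bar>F K * T\<bar>\<^sup>2\<close> to finitely many tiles and folding them
  onto the cell bounds it below by a multiple of the integral of \<open>\<bar>T\<bar>\<^sup>2\<close> over the cell, which
  is a multiple of \<open>\<Sum>(c m)\<^sup>2\<close> by orthogonality.\<close>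

lemma spline_L2_lower_bound:
  obtains \<delta> where "\<delta> > 0" and "\<And>F c. finite F \<Longrightarrow>
    \<delta> * (\<Sum>m\<in>F. (c m)\<^sup>2) \<le> (\<integral>x. (\<Sum>m\<in>F. c m * K (x - lattice_pt A m))\<^sup>2 \<partial>lborel)"
proof -
  obtain M \<eta> where M: "finite M" and \<eta>: "\<eta> > 0"
    and low: "\<And>z. z \<in> cell A \<Longrightarrow> \<eta> \<le> (\<Sum>m\<in>M. (norm (FK (z + dual_pt A m)))\<^sup>2)"
    by (rule FK_tiles_bounded_below) blast
  let ?p = "(2 * pi) ^ CARD('n)"
  show thesis
  proof
    show "\<eta> * cell_volume A / ?p > 0"
      using \<eta> cell_volume_pos[OF A] by simp
    fix F :: "(int ^ 'n) set" and c :: "int ^ 'n \<Rightarrow> real"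
    assume F: "finite F"
    let ?f = "\<lambda>x. \<Sum>m\<in>F. complex_of_real (c m) * complex_of_real (K (x - lattice_pt A m))"
    define T where "T z = (\<Sum>m\<in>F. complex_of_real (c m) * cnj (lattice_char A m z))" for z
    have [measurable]: "T \<in> borel_measurable borel"
      unfolding T_def by measurable
    have T_le: "norm (T z) \<le> (\<Sum>m\<in>F. \<bar>c m\<bar>)" for z
      unfolding T_def by (rule sum_norm_le) (simp add: norm_mult lattice_char_simps)
    have T_periodic: "T (z + dual_pt A m) = T z" for z m
      by (simp add: T_def lattice_char_simps lattice_char_periodic[OF A])
    have f_cont: "continuous_on UNIV ?f"
      by (intro continuous_intros continuous_on_compose2[OF K_cont]) auto
    have f_int: "integrable lborel ?f"
      by (intro Bochner_Integration.integrable_sum integrable_mult_right K_translate(1))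
    have Ff: "fourier ?f z = FK z * T z" for z
    proof -
      have shift: "(\<integral>x. exp (- \<i> * complex_of_real (x \<bullet> z)) * complex_of_real (K (x - lattice_pt A m)) \<partial>lborel)
          = cnj (lattice_char A m z) * FK z" for m
      proof -
        have "(\<integral>x. exp (- \<i> * complex_of_real (x \<bullet> z)) * complex_of_real (K (x - lattice_pt A m)) \<partial>lborel)
            = (\<integral>x. exp (- \<i> * complex_of_real ((lattice_pt A m + 1 *\<^sub>R x) \<bullet> z)) * complex_of_real (K ((lattice_pt A m + 1 *\<^sub>R x) - lattice_pt A m)) \<partial>lborel)"
          by (subst integral_lborel_affine[where c=1 and t="lattice_pt A m"]) simp_all
        also have "\<dots> = (\<integral>x. cnj (lattice_char A m z) * (exp (- \<i> * complex_of_real (x \<bullet> z)) * complex_of_real (K x)) \<partial>lborel)"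
          by (intro Bochner_Integration.integral_cong refl)
             (simp add: lattice_char_def exp_cnj inner_add_left exp_add[symmetric] distrib_left mult.assoc[symmetric])
        also have "\<dots> = cnj (lattice_char A m z) * FK z"
          by (subst fourier_lborel) simp_all
        finally show ?thesis .
      qed
      have int: "integrable lborel (\<lambda>x. exp (- \<i> * complex_of_real (x \<bullet> z)) * complex_of_real (K (x - w)))" for w
        by (rule Bochner_Integration.integrable_bound[OF K_translate(1)[of w]]) (measurable, simp add: norm_mult)
      have "fourier ?f z = (\<integral>x. (\<Sum>m\<in>F. complex_of_real (c m) *
          (exp (- \<i> * complex_of_real (x \<bullet> z)) * complex_of_real (K (x - lattice_pt A m)))) \<partial>lborel)"
        by (subst fourier_lborel) (simp_all add: sum_distrib_left ac_simps)
      also have "\<dots> = (\<Sum>m\<in>F. \<integral>x. complex_of_real (c m) *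
          (exp (- \<i> * complex_of_real (x \<bullet> z)) * complex_of_real (K (x - lattice_pt A m))) \<partial>lborel)"
        by (intro Bochner_Integration.integral_sum integrable_mult_right int)
      also have "\<dots> = FK z * T z"
        unfolding integral_mult_right_zero shift T_def by (simp add: sum_distrib_left ac_simps)
      finally show ?thesis .
    qed
    have Ff_int: "integrable lborel (\<lambda>z. FK z * T z)"
    proof (rule Bochner_Integration.integrable_bound)
      show "integrable lborel (\<lambda>z. (\<Sum>m\<in>F. \<bar>c m\<bar>) * norm (FK z))"
        using FK_integrable by auto
      show "AE z in lborel. norm (FK z * T z) \<le> norm ((\<Sum>m\<in>F. \<bar>c m\<bar>) * norm (FK z))"
        using T_le by (auto simp: norm_mult abs_mult mult.commute intro!: mult_right_mono order_trans[OF T_le abs_ge_self])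
    qed measurable
    let ?h = "\<lambda>z. (norm (FK z * T z))\<^sup>2"
    obtain D where D: "norm (FK z) \<le> D" for z
      using norm_fourier_le[OF K_integrable] by metis
    have h_int: "integrable lborel ?h"
    proof (rule integrable_norm_square_if_bounded[OF Ff_int])
      show "norm (FK z * T z) \<le> D * (\<Sum>m\<in>F. \<bar>c m\<bar>)" for z
        unfolding norm_mult by (intro mult_mono D T_le order_trans[OF norm_ge_zero D]) simp
    qed
    have cell_int: "integrable lborel (\<lambda>z. indicator (cell A) z * ?h (z + dual_pt A m))" for m
    proof (rule integrable_cell[OF A])
      show "norm (?h (z + dual_pt A m)) \<le> (D * (\<Sum>m\<in>F. \<bar>c m\<bar>))\<^sup>2" if "z \<in> cell A" for z
        unfolding real_norm_def norm_mult abs_power2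
        by (intro power_mono mult_mono D T_le order_trans[OF norm_ge_zero D]) simp_all
    qed measurable
    have "\<eta> * (cell_volume A * (\<Sum>m\<in>F. (c m)\<^sup>2)) = \<eta> * (\<integral>z. indicator (cell A) z * (norm (T z))\<^sup>2 \<partial>lborel)"
      unfolding T_def trigonometric_polynomial_norm[OF A F] by simp
    also have "\<dots> = (\<integral>z. \<eta> * (indicator (cell A) z * (norm (T z))\<^sup>2) \<partial>lborel)"
      by simp
    also have "\<dots> \<le> (\<integral>z. (\<Sum>m\<in>M. indicator (cell A) z * ?h (z + dual_pt A m)) \<partial>lborel)"
    proof (rule integral_mono)
      show "integrable lborel (\<lambda>z. \<eta> * (indicator (cell A) z * (norm (T z))\<^sup>2))"
        by (intro integrable_mult_right integrable_cell[OF A, where C="(\<Sum>m\<in>F. \<bar>c m\<bar>)\<^sup>2"])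
           (measurable, simp add: T_le power_mono)
      show "integrable lborel (\<lambda>z. \<Sum>m\<in>M. indicator (cell A) z * ?h (z + dual_pt A m))"
        by (intro Bochner_Integration.integrable_sum cell_int)
      fix z
      have "(\<Sum>m\<in>M. indicator (cell A) z * ?h (z + dual_pt A m)) =
          indicator (cell A) z * (norm (T z))\<^sup>2 * (\<Sum>m\<in>M. (norm (FK (z + dual_pt A m)))\<^sup>2)"
        by (simp add: T_periodic norm_mult power_mult_distrib sum_distrib_left ac_simps)
      moreover have "indicator (cell A) z * (norm (T z))\<^sup>2 * \<eta> \<le>
          indicator (cell A) z * (norm (T z))\<^sup>2 * (\<Sum>m\<in>M. (norm (FK (z + dual_pt A m)))\<^sup>2)"
        using low[of z] by (auto split: split_indicator intro: mult_left_mono)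
      ultimately show "\<eta> * (indicator (cell A) z * (norm (T z))\<^sup>2) \<le> (\<Sum>m\<in>M. indicator (cell A) z * ?h (z + dual_pt A m))"
        by (simp add: ac_simps)
    qed
    also have "\<dots> = (\<Sum>m\<in>M. \<integral>z. indicator (cell A) (z - dual_pt A m) * ?h z \<partial>lborel)"
      by (subst Bochner_Integration.integral_sum, rule cell_int, subst integral_tile_shift[OF A]) simp_all
    also have "\<dots> \<le> (\<integral>z. ?h z \<partial>lborel)"
      by (rule sum_tiles_le[OF A h_int _ M]) simp
    also have "\<dots> = ?p * (\<integral>x. (norm (?f x))\<^sup>2 \<partial>lborel)"
      using plancherel[OF f_cont f_int] Ff_int by (simp add: Ff[abs_def])
    also have "(\<lambda>x. (norm (?f x))\<^sup>2) = (\<lambda>x. (\<Sum>m\<in>F. c m * K (x - lattice_pt A m))\<^sup>2)"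
      by (simp only: of_real_mult[symmetric] of_real_sum[symmetric] norm_of_real power2_abs)
    finally show "\<eta> * cell_volume A / ?p * (\<Sum>m\<in>F. (c m)\<^sup>2) \<le> (\<integral>x. (\<Sum>m\<in>F. c m * K (x - lattice_pt A m))\<^sup>2 \<partial>lborel)"
      by (simp add: field_simps)
  qed
qed

text \<open>Partial sums over sets containing some finite \<open>F0\<close> are close to \<open>g\<close> in \<open>L\<^sub>2\<close>, hence close to each
  other. So the partial sum over a finite set disjoint from \<open>F0\<close> has bounded norm, and the lower bound
  controls its coefficients.\<close>

lemma spline_coefficients_square_summable:
  assumes g: "in_L2 g" and series: "sk_series A K c g"
  shows "(\<lambda>m. (c m)\<^sup>2) summable_on UNIV"
proof -
  obtain \<delta> where \<delta>: "\<delta> > 0" and low: "\<And>F c. finite F \<Longrightarrow>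
    \<delta> * (\<Sum>m\<in>F. (c m)\<^sup>2) \<le> (\<integral>x. (\<Sum>m\<in>F. c m * K (x - lattice_pt A m))\<^sup>2 \<partial>lborel)"
    by (rule spline_L2_lower_bound) blast
  define s where "s F x = (\<Sum>m\<in>F. complex_of_real (c m * K (x - lattice_pt A m)))" for F x
  let ?e = "\<lambda>F. \<integral>\<^sup>+x. ennreal ((norm (g x - s F x))\<^sup>2) \<partial>lebesgue"
  have g_meas [measurable]: "g \<in> borel_measurable lebesgue"
    using g by (simp add: in_L2_def)
  have s_borel: "s F \<in> borel_measurable borel" for F
    unfolding s_def by measurable
  have s_meas [measurable]: "s F \<in> borel_measurable lebesgue" for F
    by (rule measurable_completion) (simp add: s_borel)
  have "(?e \<longlongrightarrow> 0) (finite_subsets_at_top UNIV)"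
    using series unfolding sk_series_def s_def by blast
  then have "\<forall>\<^sub>F F in finite_subsets_at_top UNIV. ?e F < 1"
    by (rule order_tendstoD(2)) simp
  then obtain F0 where F0: "finite F0" and small: "\<And>F. finite F \<Longrightarrow> F0 \<subseteq> F \<Longrightarrow> ?e F < 1"
    unfolding eventually_finite_subsets_at_top by auto
  have tail: "\<delta> * (\<Sum>m\<in>F - F0. (c m)\<^sup>2) \<le> 4" if F: "finite F" for F
  proof -
    let ?G = "F - F0" and ?F1 = "F0 \<union> F"
    let ?t = "\<lambda>x. (\<Sum>m\<in>?G. c m * K (x - lattice_pt A m))\<^sup>2"
    have diff: "s ?F1 x - s F0 x = complex_of_real (\<Sum>m\<in>?G. c m * K (x - lattice_pt A m))" for x
    proof -
      have "s ?F1 x = s F0 x + s ?G x"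
        unfolding s_def using F F0 by (subst sum.union_disjoint[symmetric]) (auto simp: Un_Diff_cancel)
      then show ?thesis
        by (simp add: s_def)
    qed
    have pt: "?t x \<le> 2 * (norm (g x - s ?F1 x))\<^sup>2 + 2 * (norm (g x - s F0 x))\<^sup>2" for x
    proof -
      have "?t x = (norm (s ?F1 x - s F0 x))\<^sup>2"
        unfolding diff norm_of_real by simp
      also have "norm (s ?F1 x - s F0 x) \<le> norm (g x - s ?F1 x) + norm (g x - s F0 x)"
        using norm_triangle_ineq4[of "g x - s F0 x" "g x - s ?F1 x"] by simp
      then have "(norm (s ?F1 x - s F0 x))\<^sup>2 \<le> (norm (g x - s ?F1 x) + norm (g x - s F0 x))\<^sup>2"
        by (intro power_mono) auto
      also have "\<dots> \<le> 2 * (norm (g x - s ?F1 x))\<^sup>2 + 2 * (norm (g x - s F0 x))\<^sup>2"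
        using sum_squares_bound[of "norm (g x - s ?F1 x)" "norm (g x - s F0 x)"]
        by (simp add: power2_sum)
      finally show ?thesis .
    qed
    have t_borel: "?t \<in> borel_measurable borel"
      by measurable
    have "(\<integral>\<^sup>+x. ennreal (?t x) \<partial>lborel) = (\<integral>\<^sup>+x. ennreal (?t x) \<partial>lebesgue)"
      by (rule nn_integral_completion[symmetric])
    also have "\<dots> \<le> (\<integral>\<^sup>+x. 2 * ennreal ((norm (g x - s ?F1 x))\<^sup>2) + 2 * ennreal ((norm (g x - s F0 x))\<^sup>2) \<partial>lebesgue)"
    proof (rule nn_integral_mono)
      fix x
      have "ennreal (?t x) \<le> ennreal (2 * (norm (g x - s ?F1 x))\<^sup>2 + 2 * (norm (g x - s F0 x))\<^sup>2)"
        by (intro ennreal_leI pt)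
      also have "\<dots> = 2 * ennreal ((norm (g x - s ?F1 x))\<^sup>2) + 2 * ennreal ((norm (g x - s F0 x))\<^sup>2)"
        by (simp add: ennreal_plus ennreal_mult')
      finally show "ennreal (?t x) \<le> 2 * ennreal ((norm (g x - s ?F1 x))\<^sup>2) + 2 * ennreal ((norm (g x - s F0 x))\<^sup>2)" .
    qed
    also have "\<dots> = 2 * ?e ?F1 + 2 * ?e F0"
      by (subst nn_integral_add) (simp_all add: nn_integral_cmult)
    also have "\<dots> \<le> 2 * 1 + 2 * 1"
      using small[of ?F1] small[of F0] F F0 by (intro add_mono mult_left_mono) (auto intro: less_imp_le)
    finally have nn: "(\<integral>\<^sup>+x. ennreal (?t x) \<partial>lborel) \<le> 4"
      by simp
    have "(\<integral>x. ?t x \<partial>lborel) = enn2real (\<integral>\<^sup>+x. ennreal (?t x) \<partial>lborel)"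
      using t_borel by (intro integral_eq_nn_integral) auto
    also have "\<dots> \<le> enn2real 4"
      using nn by (intro enn2real_mono) auto
    finally have "(\<integral>x. ?t x \<partial>lborel) \<le> 4"
      by simp
    then show ?thesis
      using low[of ?G c] F by (simp add: order_trans)
  qed
  show ?thesis
  proof (rule nonneg_bdd_above_summable_on)
    show "bdd_above (sum (\<lambda>m. (c m)\<^sup>2) ` {F. F \<subseteq> UNIV \<and> finite F})"
    proof (rule bdd_aboveI2)
      fix F :: "(int ^ 'n) set" assume "F \<in> {F. F \<subseteq> UNIV \<and> finite F}"
      then have F: "finite F" by simp
      have "(\<Sum>m\<in>F. (c m)\<^sup>2) \<le> (\<Sum>m\<in>F0 \<union> (F - F0). (c m)\<^sup>2)"
        using F F0 by (intro sum_mono2) auto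
      also have "\<dots> = (\<Sum>m\<in>F0. (c m)\<^sup>2) + (\<Sum>m\<in>F - F0. (c m)\<^sup>2)"
        using F F0 by (intro sum.union_disjoint) auto
      also have "(\<Sum>m\<in>F - F0. (c m)\<^sup>2) \<le> 4 / \<delta>"
        using tail[OF F] \<delta> by (simp add: field_simps)
      finally show "(\<Sum>m\<in>F. (c m)\<^sup>2) \<le> (\<Sum>m\<in>F0. (c m)\<^sup>2) + 4 / \<delta>"
        by simp
    qed
  qed simp
qed

lemma interpolation_equations:
  assumes series: "\<And>x. ((\<lambda>m. complex_of_real (c m * K (x - lattice_pt A m))) has_sum g x) UNIV"
    and g: "\<And>s. g (lattice_pt A s) = (if s = 0 then 1 else 0)"
  shows "((\<lambda>m. c m * K (lattice_pt A (s - m))) has_sum (if s = 0 then 1 else 0)) UNIV"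
proof -
  have "((\<lambda>m. complex_of_real (c m * K (lattice_pt A (s - m)))) has_sum complex_of_real (if s = 0 then 1 else 0)) UNIV"
    using series[of "lattice_pt A s"] g[of s] by (simp add: lattice_pt_simps if_distrib cong: if_cong)
  then show ?thesis
    by (simp only: has_sum_of_real_iff)
qed

lemma fundamental_sk_spline_unique:
  assumes "fundamental_sk_spline A K g"
  shows "g = sk_tilde A K"
proof
  fix x
  obtain c where g: "in_L2 g" and series: "sk_series A K c g"
      and vals: "\<And>s. g (lattice_pt A s) = (if s = 0 then 1 else 0)"
    using assms unfolding fundamental_sk_spline_def SK_def by auto
  have sum: "((\<lambda>m. complex_of_real (c m * K (x - lattice_pt A m))) has_sum g x) UNIV" for x
    using series by (simp add: sk_series_def)
  have "coeff = c"
    using convolution_inverse_unique[OF coeff_summable kernel_samples_square_summable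
        spline_coefficients_square_summable[OF g series]
        interpolation_equations[OF sk_tilde_has_sum sk_tilde_at_lattice]
        interpolation_equations[OF sum vals]] .
  then show "g x = sk_tilde A K x"
    using sk_tilde_has_sum[of x] sum[of x] by (metis has_sum_unique)
qed

end

theorem theorem3:
  fixes A :: "real ^ 'n ^ 'n"
    and K :: "real ^ 'n \<Rightarrow> real"
    and \<alpha> :: "int ^ 'n \<Rightarrow> complex"
  assumes A: "invertible A"
    and K_L2: "in_L2 (\<lambda>x. complex_of_real (K x))"
    and K_L1: "in_L1 (\<lambda>x. complex_of_real (K x))"
    and K_cont: "continuous_on UNIV K"
    and nonzero: "\<forall>z \<in> dual_map A ` unit_cube.
        periodization A (fourier (\<lambda>x. complex_of_real (K x))) z \<noteq> 0"
    and fourier_series: "\<forall>z. ((\<lambda>s. \<alpha> s * exp (- \<i> * complex_of_real (lattice_pt A s \<bullet> z)))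
        has_sum Upsilon A K z) UNIV"
    \<comment> \<open>the integral in the formula for the spline exists\<close>
    and integral_exists: "\<forall>x. integrable lebesgue
        (\<lambda>z. Upsilon A K z * fourier (\<lambda>x. complex_of_real (K x)) z *
             exp (\<i> * complex_of_real (z \<bullet> x)))"
  shows "fundamental_sk_spline A K (sk_tilde A K) \<and>
         (\<forall>g. fundamental_sk_spline A K g \<longrightarrow> g = sk_tilde A K)"
proof -
  interpret cardinal_interpolation A K \<alpha>
    using assms by unfold_locales
  show ?thesis
    using sk_tilde_fundamental fundamental_sk_spline_unique by blast
qed

end
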